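(* Let $I\subseteq\mathbb{R}$ be a nonempty open interval. (Sufficiency) Let $p\in\mathbb{R}$, let $\varphi:I\to\mathbb{R}_+$ be a positive continuous function, and let $(f,g),(h,k)\in\mathscr{B}_0(I)$ be such that, on $I$, $$(f,g)\sim(S_p/\varphi,\;C_p/\varphi)\qquad\text{and}\qquad (h,k)\sim(S_p\cdot\varphi,\;C_p\cdot\varphi).$$ Then, for all $s,t\in\mathbb{R}_+$, the invariance equation $$B_{f,g}(x,y;t,s)+B_{h,k}(x,y;s,t)=x+y\qquad\text{for all }x,y\in I$$ holds. (Necessity) Conversely, let $(f,g),(h,k)\in\mathscr{B}_4(I)$ and let $t,s\in\mathbb{R}_+$ with $t\neq s$ be such that $$B_{f,g}(x,y;t,s)+B_{h,k}(x,y;s,t)=x+y\qquad\text{for all }x,y\in I.$$ Then there exist a positive, four times continuously differentiable function $\varphi:I\to\mathbb{R}_+$ and a real parameter $p\in\mathbb{R}$ such that, on $I$, $$(f,g)\sim(S_p/\varphi,\;C_p/\varphi)\qquad\text{and}\qquad (h,k)\sim(S_p\cdot\varphi,\;C_p\cdot\varphi).$$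
   Context: $\mathbb{R}_+$ denotes the set of positive real numbers. Regularity classes. $\mathscr{B}_0(I)$ is the class of all pairs $(f,g)$ of continuous functions $f,g:I\to\mathbb{R}$ such that $g$ is nowhere zero on $I$ and $f/g$ is strictly monotone on $I$. For $n\ge 1$, $\mathscr{B}_n(I)$ is the class of all pairs $(f,g)$ of $n$ times continuously differentiable functions $f,g:I\to\mathbb{R}$ such that $g$ is nowhere zero on $I$ and $(f/g)'$ is nowhere zero on $I$. One has $\mathscr{B}_n(I)\subseteq\mathscr{B}_0(I)$. Weighted two-variable Bajraktarević mean. For $(f,g)\in\mathscr{B}_0(I)$, $x,y\in I$ and $t,s\in\mathbb{R}_+$, $$B_{f,g}(x,y;t,s):=\Big(\frac{f}{g}\Big)^{-1}\Big(\frac{tf(x)+sf(y)}{tg(x)+sg(y)}\Big)\in I .$$ Equivalence. Two pairs of real-valued functions $(f,g)$ and $(h,k)$ on $I$ are called equivalent, written $(f,g)\sim(h,k)$, if there exist real constants $a,b,c,d$ with $ad\neq bc$ such that $h=af+bg$ and $k=cf+dg$ on $I$. Sine and cosine type functions. For $p\in\mathbb{R}$, the functions $S_p,C_p:\mathbb{R}\to\mathbb{R}$ are defined by $S_p(x)=\sin(\sqrt{-p}\,x)$, $C_p(x)=\cos(\sqrt{-p}\,x)$ if $p<0$; $S_p(x)=x$, $C_p(x)=1$ if $p=0$; $S_p(x)=\sinh(\sqrt{p}\,x)$, $C_p(x)=\cosh(\sqrt{p}\,x)$ if $p>0$. In the claim they are restricted to $I$. *)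

theory Defs
  imports "HOL-Analysis.Analysis"
begin

text \<open>
  Functions on an open interval \<open>I\<close> are represented by total functions \<open>real \<Rightarrow> real\<close>; only their
  values on \<open>I\<close> matter.  Since \<open>I\<close> is open, the iterated \<^const>\<open>deriv\<close> at a point of \<open>I\<close> depends
  only on the values on \<open>I\<close>.  The definition below is not meant for sets that are not open.
\<close>

definition times_cont_diff_on :: "nat \<Rightarrow> (real \<Rightarrow> real) \<Rightarrow> real set \<Rightarrow> bool" where
  "times_cont_diff_on n f I \<longleftrightarrow>
     (\<forall>i<n. (deriv ^^ i) f differentiable_on I) \<and> continuous_on I ((deriv ^^ n) f)"

definition reg_class :: "nat \<Rightarrow> real set \<Rightarrow> ((real \<Rightarrow> real) \<times> (real \<Rightarrow> real)) set" where
  "reg_class n I =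
     (if n = 0 then
        {(f, g). continuous_on I f \<and> continuous_on I g \<and> (\<forall>x\<in>I. g x \<noteq> 0) \<and>
           (strict_mono_on I (\<lambda>x. f x / g x) \<or> strict_antimono_on I (\<lambda>x. f x / g x))}
      else
        {(f, g). times_cont_diff_on n f I \<and> times_cont_diff_on n g I \<and> (\<forall>x\<in>I. g x \<noteq> 0) \<and>
           (\<forall>x\<in>I. deriv (\<lambda>x. f x / g x) x \<noteq> 0)})"

text \<open>
  For \<open>(f, g) \<in> reg_class 0 I\<close>, \<open>x, y \<in> I\<close> and \<open>t, s > 0\<close>, the quotient \<open>f / g\<close> is injective on \<open>I\<close>
  and takes the value below at exactly one point of \<open>I\<close>.  Outside this range of parameters the
  value is unspecified.
\<close>

definition bajraktarevic_mean ::
  "real set \<Rightarrow> (real \<Rightarrow> real) \<Rightarrow> (real \<Rightarrow> real) \<Rightarrow> real \<Rightarrow> real \<Rightarrow> real \<Rightarrow> real \<Rightarrow> real" where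
  "bajraktarevic_mean I f g x y t s =
     the_inv_into I (\<lambda>u. f u / g u) ((t * f x + s * f y) / (t * g x + s * g y))"

definition pair_equiv_on ::
  "real set \<Rightarrow> (real \<Rightarrow> real) \<times> (real \<Rightarrow> real) \<Rightarrow> (real \<Rightarrow> real) \<times> (real \<Rightarrow> real) \<Rightarrow> bool" where
  "pair_equiv_on I = (\<lambda>(f, g) (h, k).
     \<exists>a b c d. a * d \<noteq> b * c \<and>
       (\<forall>x\<in>I. h x = a * f x + b * g x \<and> k x = c * f x + d * g x))"

definition sin_type :: "real \<Rightarrow> real \<Rightarrow> real" where
  "sin_type p x =
     (if p < 0 then sin (sqrt (- p) * x) else if p = 0 then x else sinh (sqrt p * x))"

definition cos_type :: "real \<Rightarrow> real \<Rightarrow> real" where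
  "cos_type p x =
     (if p < 0 then cos (sqrt (- p) * x) else if p = 0 then 1 else cosh (sqrt p * x))"

end

theory Submission
  imports Defs
begin

text \<open>
  Write \<open>[f, g](b, a)\<close> for the determinant \<open>f(b) g(a) - f(a) g(b)\<close>.  The mean \<open>u\<close> of \<open>x, y\<close> with
  weights \<open>t, s\<close> generated by \<open>(f, g)\<close> is the unique solution of
  \<open>t [f, g](u, x) = s [f, g](y, u)\<close>, and invariance says that \<open>v = x + y - u\<close> is the mean generated by
  \<open>(h, k)\<close> with exchanged weights.  The point \<open>v\<close> satisfies \<open>v - x = y - u\<close> and \<open>y - v = u - x\<close>.  For
  sine and cosine type functions the determinant is \<open>S\<^sub>p(b - a)\<close> by the addition theorem, so the
  equations of \<open>u\<close> and \<open>v\<close> are the same up to a factor; this is the sufficiency part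
  (\<open>invariance_of_sin_cos_type\<close>).

  For necessity, the pairs are first normalized (\<open>normal_form_exists\<close>): up to signs,
  \<open>(f, g) = w (F, G)\<close> and \<open>(h, k) = z (H, K)\<close>, where \<open>F, G\<close> solve \<open>Y'' = P Y\<close>, \<open>H, K\<close> solve
  \<open>Y'' = Q Y\<close>, and both Wronskians are 1.  Multiplying the equations of \<open>u\<close> and \<open>v\<close> removes the
  weights and gives
    \<open>w(x) z(x) [F, G](u, x) [H, K](v, x) = w(y) z(y) [F, G](y, u) [H, K](y, v)\<close>.
  The determinant of a normalized pair over a short interval of length \<open>l\<close> and midpoint \<open>c\<close> is
  \<open>l + P(c) l\<^sup>3 / 6 + o(l\<^sup>4)\<close> (\<open>wedge_expansion\<close>).  As \<open>y\<close> tends to \<open>x\<close>, the point \<open>u\<close> divides the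
  interval from \<open>x\<close> to \<open>y\<close> in the limiting ratio \<open>s : t\<close> (\<open>bajraktarevic_mean_slope\<close>), and comparing
  the two sides order by order yields first that \<open>w z\<close> is constant, then \<open>P = Q\<close> because \<open>t \<noteq> s\<close>, and
  finally \<open>P' = 0\<close> (\<open>invariance_forces_constant_potential\<close>).  So both pairs solve \<open>Y'' = p Y\<close> with one
  constant \<open>p\<close> and therefore have the same linear span as \<open>S\<^sub>p, C\<^sub>p\<close>; the function \<open>\<phi> = 1 / w\<close> is
  proportional to \<open>z\<close>.
\<close>

section \<open>Calculus of n times continuously differentiable functions\<close>

lemma times_cont_diff_on_0: "times_cont_diff_on 0 f I \<longleftrightarrow> continuous_on I f"
  by (simp add: times_cont_diff_on_def)

lemma times_cont_diff_on_Suc: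
  "times_cont_diff_on (Suc n) f I \<longleftrightarrow> f differentiable_on I \<and> times_cont_diff_on n (deriv f) I"
  unfolding times_cont_diff_on_def All_less_Suc2
  by (simp add: funpow_Suc_right del: funpow.simps)

lemma has_derivative_deriv_of_differentiable_on:
  fixes f :: "real \<Rightarrow> real"
  assumes "open I" "f differentiable_on I" "x \<in> I"
  shows "(f has_real_derivative deriv f x) (at x)"
proof -
  have "f differentiable (at x)"
    using assms by (metis at_within_open differentiable_on_def)
  then show ?thesis
    by (simp add: DERIV_deriv_iff_real_differentiable)
qed

lemma deriv_cong_on_open:
  fixes f g :: "real \<Rightarrow> real"
  assumes "open I" "x \<in> I" "\<And>x. x \<in> I \<Longrightarrow> f x = g x"
  shows "deriv f x = deriv g x"
  using assms by (intro deriv_cong_ev refl) (auto intro!: eventually_nhds_in_open[THEN eventually_mono])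

lemma times_cont_diff_on_cong:
  assumes "open I" "\<And>x. x \<in> I \<Longrightarrow> f x = g x" "times_cont_diff_on n f I"
  shows "times_cont_diff_on n g I"
  using assms(2,3)
proof (induction n arbitrary: f g)
  case 0
  then show ?case by (simp add: times_cont_diff_on_0 cong: continuous_on_cong)
next
  case (Suc n)
  have "f differentiable_on I" "times_cont_diff_on n (deriv f) I"
    using Suc.prems by (auto simp: times_cont_diff_on_Suc)
  moreover have "deriv f x = deriv g x" if "x \<in> I" for x
    using deriv_cong_on_open[OF \<open>open I\<close> that] Suc.prems(1) by blast
  moreover have "g differentiable_on I"
    using \<open>f differentiable_on I\<close> Suc.prems(1)
    by (auto simp: differentiable_on_def intro: differentiable_transform_within[OF _ zero_less_one])
  ultimately show ?case
    using Suc.IH[of "deriv f" "deriv g"] by (simp add: times_cont_diff_on_Suc)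
qed

text \<open>
  The calculus below never touches iterated derivatives: by this rule and its
  converse, a function is \<open>n + 1\<close> times continuously differentiable iff it has a derivative that is \<open>n\<close> times continuously
  differentiable, so every closure property is an induction on \<open>n\<close> that quotes the usual
  differentiation rule.
\<close>

lemma times_cont_diff_on_SucI:
  assumes "open I" "\<And>x. x \<in> I \<Longrightarrow> (f has_real_derivative f' x) (at x)" "times_cont_diff_on n f' I"
  shows "times_cont_diff_on (Suc n) f I"
  unfolding times_cont_diff_on_Suc
proof
  show "f differentiable_on I"
    using assms(2) by (auto intro!: differentiable_at_imp_differentiable_on simp: real_differentiable_def, blast)
  show "times_cont_diff_on n (deriv f) I"
    by (rule times_cont_diff_on_cong[OF assms(1) _ assms(3)]) (metis DERIV_imp_deriv assms(2))
qed

lemma times_cont_diff_on_SucE: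
  assumes "open I" "times_cont_diff_on (Suc n) f I"
  obtains f' where "\<And>x. x \<in> I \<Longrightarrow> (f has_real_derivative f' x) (at x)" "times_cont_diff_on n f' I"
  using assms has_derivative_deriv_of_differentiable_on times_cont_diff_on_Suc by blast

lemma times_cont_diff_on_imp_continuous_on:
  assumes "open I" "times_cont_diff_on n f I"
  shows "continuous_on I f"
proof (cases n)
  case 0 then show ?thesis using assms by (simp add: times_cont_diff_on_0)
next
  case (Suc m) then show ?thesis using assms
    by (simp add: times_cont_diff_on_Suc differentiable_imp_continuous_on)
qed

lemma times_cont_diff_on_pred:
  assumes "open I" "times_cont_diff_on (Suc n) f I"
  shows "times_cont_diff_on n f I"
  using assms(2)
proof (induction n arbitrary: f)
  case 0
  then show ?case using times_cont_diff_on_imp_continuous_on[OF assms(1)] times_cont_diff_on_0 by blast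
next
  case (Suc n)
  then show ?case by (simp add: times_cont_diff_on_Suc)
qed

lemma times_cont_diff_on_diff:
  assumes "open I" "times_cont_diff_on n f I" "times_cont_diff_on n g I"
  shows "times_cont_diff_on n (\<lambda>x. f x - g x) I"
  using assms(2,3)
proof (induction n arbitrary: f g)
  case 0
  then show ?case by (auto simp: times_cont_diff_on_0 intro: continuous_intros)
next
  case (Suc n)
  obtain f' g' where
    "\<And>x. x \<in> I \<Longrightarrow> (f has_real_derivative f' x) (at x)" "times_cont_diff_on n f' I"
    "\<And>x. x \<in> I \<Longrightarrow> (g has_real_derivative g' x) (at x)" "times_cont_diff_on n g' I"
    using Suc.prems times_cont_diff_on_SucE[OF assms(1)] by metis
  then show ?case
    by (intro times_cont_diff_on_SucI[OF assms(1), where f' = "\<lambda>x. f' x - g' x"] Suc.IH)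
       (auto intro!: derivative_eq_intros)
qed

lemma times_cont_diff_on_add:
  assumes "open I" "times_cont_diff_on n f I" "times_cont_diff_on n g I"
  shows "times_cont_diff_on n (\<lambda>x. f x + g x) I"
  using assms(2,3)
proof (induction n arbitrary: f g)
  case 0
  then show ?case by (auto simp: times_cont_diff_on_0 intro: continuous_intros)
next
  case (Suc n)
  obtain f' g' where
    "\<And>x. x \<in> I \<Longrightarrow> (f has_real_derivative f' x) (at x)" "times_cont_diff_on n f' I"
    "\<And>x. x \<in> I \<Longrightarrow> (g has_real_derivative g' x) (at x)" "times_cont_diff_on n g' I"
    using Suc.prems times_cont_diff_on_SucE[OF assms(1)] by metis
  then show ?case
    by (intro times_cont_diff_on_SucI[OF assms(1), where f' = "\<lambda>x. f' x + g' x"] Suc.IH)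
       (auto intro!: derivative_eq_intros)
qed

lemma times_cont_diff_on_mult:
  assumes "open I" "times_cont_diff_on n f I" "times_cont_diff_on n g I"
  shows "times_cont_diff_on n (\<lambda>x. f x * g x) I"
  using assms(2,3)
proof (induction n arbitrary: f g)
  case 0
  then show ?case by (auto simp: times_cont_diff_on_0 intro: continuous_intros)
next
  case (Suc n)
  obtain f' g' where
    "\<And>x. x \<in> I \<Longrightarrow> (f has_real_derivative f' x) (at x)" "times_cont_diff_on n f' I"
    "\<And>x. x \<in> I \<Longrightarrow> (g has_real_derivative g' x) (at x)" "times_cont_diff_on n g' I"
    using Suc.prems times_cont_diff_on_SucE[OF assms(1)] by metis
  moreover have "times_cont_diff_on n f I" "times_cont_diff_on n g I"
    using Suc.prems times_cont_diff_on_pred[OF assms(1)] by auto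
  ultimately show ?case
    by (intro times_cont_diff_on_SucI[OF assms(1), where f' = "\<lambda>x. f' x * g x + f x * g' x"]
          times_cont_diff_on_add[OF assms(1)] Suc.IH)
       (auto intro!: derivative_eq_intros)
qed

lemma times_cont_diff_on_const:
  assumes "open I"
  shows "times_cont_diff_on n (\<lambda>x. c) I"
proof (induction n arbitrary: c)
  case 0
  then show ?case by (auto simp: times_cont_diff_on_0)
next
  case (Suc n)
  then show ?case
    by (intro times_cont_diff_on_SucI[OF assms(1), where f' = "\<lambda>x. 0"])
       (auto intro!: derivative_eq_intros)
qed

text \<open>
  The derivative \<open>- f' / f\<^sup>2\<close> is written as a product involving \<open>1 / f\<close> itself, to which the induction
  hypothesis applies.  The square root is treated in the same way.
\<close>

lemma times_cont_diff_on_inverse: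
  assumes "open I" "times_cont_diff_on n f I" "\<And>x. x \<in> I \<Longrightarrow> f x \<noteq> 0"
  shows "times_cont_diff_on n (\<lambda>x. inverse (f x)) I"
  using assms(2)
proof (induction n)
  case 0
  then show ?case using assms by (auto simp: times_cont_diff_on_0 intro!: continuous_intros)
next
  case (Suc n)
  obtain f' where
    "\<And>x. x \<in> I \<Longrightarrow> (f has_real_derivative f' x) (at x)" "times_cont_diff_on n f' I"
    using Suc.prems times_cont_diff_on_SucE[OF assms(1)] by metis
  moreover have "times_cont_diff_on n (\<lambda>x. inverse (f x)) I"
    using Suc times_cont_diff_on_pred[OF assms(1)] by auto
  ultimately show ?case
    by (intro times_cont_diff_on_SucI[OF assms(1),
            where f' = "\<lambda>x. 0 - inverse (f x) * f' x * inverse (f x)"]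
          times_cont_diff_on_diff times_cont_diff_on_const times_cont_diff_on_mult assms(1))
       (auto intro!: derivative_eq_intros assms(3))
qed

lemma times_cont_diff_on_divide:
  assumes "open I" "times_cont_diff_on n f I" "times_cont_diff_on n g I" "\<And>x. x \<in> I \<Longrightarrow> g x \<noteq> 0"
  shows "times_cont_diff_on n (\<lambda>x. f x / g x) I"
  using times_cont_diff_on_mult[OF assms(1,2) times_cont_diff_on_inverse[OF assms(1,3,4)]]
  by (simp add: divide_inverse)

lemma times_cont_diff_on_sqrt:
  assumes "open I" "times_cont_diff_on n f I" "\<And>x. x \<in> I \<Longrightarrow> f x > 0"
  shows "times_cont_diff_on n (\<lambda>x. sqrt (f x)) I"
  using assms(2)
proof (induction n)
  case 0
  then show ?case using assms by (auto simp: times_cont_diff_on_0 intro!: continuous_intros)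
next
  case (Suc n)
  obtain f' where f':
    "\<And>x. x \<in> I \<Longrightarrow> (f has_real_derivative f' x) (at x)" "times_cont_diff_on n f' I"
    using Suc.prems times_cont_diff_on_SucE[OF assms(1)] by metis
  have "times_cont_diff_on n (\<lambda>x. sqrt (f x)) I"
    using Suc times_cont_diff_on_pred[OF assms(1)] by auto
  then have "times_cont_diff_on n (\<lambda>x. f' x * inverse (2 * sqrt (f x))) I"
    using assms(3)
    by (intro times_cont_diff_on_mult times_cont_diff_on_inverse times_cont_diff_on_const assms(1) f')
       force+
  then show ?case
    by (rule times_cont_diff_on_SucI[OF assms(1), rotated])
       (auto intro!: derivative_eq_intros f' simp: field_simps dest: assms(3))
qed

section \<open>The implicit equation of the mean and sufficiency\<close>

text \<open>
  The determinant of the values of \<open>(f, g)\<close> at \<open>b\<close> and \<open>a\<close>.  A linear change of the pair multiplies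
  it by a constant, and in terms of it the implicit equation of the mean is linear in the weights
  and free of quotients.
\<close>

definition wedge :: "(real \<Rightarrow> real) \<Rightarrow> (real \<Rightarrow> real) \<Rightarrow> real \<Rightarrow> real \<Rightarrow> real" where
  "wedge f g b a = f b * g a - f a * g b"

lemma closed_segment_subset_interval:
  fixes J :: "real set"
  assumes "is_interval J" "a \<in> J" "b \<in> J"
  shows "closed_segment a b \<subseteq> J"
  using assms by (simp add: closed_segment_subset is_interval_convex_1)

text \<open>
  Hence the denominator \<open>t g(x) + s g(y)\<close> of the mean never vanishes.
\<close>

lemma nonzero_on_interval_same_sign:
  fixes g :: "real \<Rightarrow> real"
  assumes "is_interval I" "continuous_on I g" "\<And>x. x \<in> I \<Longrightarrow> g x \<noteq> 0" "x \<in> I" "y \<in> I"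
  shows "g x * g y > 0"
proof (rule ccontr)
  assume "\<not> g x * g y > 0"
  then have "0 \<in> closed_segment (g x) (g y)"
    by (auto simp: closed_segment_eq_real_ivl zero_less_mult_iff not_less split: if_splits)
  moreover have "is_interval (g ` I)"
    using assms by (metis connected_continuous_image is_interval_connected_1)
  ultimately have "0 \<in> g ` I"
    using closed_segment_subset_interval[of "g ` I" "g x" "g y"] assms(4,5) by blast
  then show False using assms(3) by auto
qed

text \<open>
  Clearing denominators in \<open>f(u)/g(u) = (t f(x) + s f(y)) / (t g(x) + s g(y))\<close> gives the equation
  \<open>t (f(u) g(x) - f(x) g(u)) = s (f(y) g(u) - f(u) g(y))\<close>; as \<open>f/g\<close> is injective, it determines \<open>u\<close>.
\<close>

lemma bajraktarevic_mean_eqI: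
  assumes "is_interval I" "continuous_on I g" "\<And>x. x \<in> I \<Longrightarrow> g x \<noteq> 0"
    and "inj_on (\<lambda>x. f x / g x) I" "x \<in> I" "y \<in> I" "t > 0" "s > 0"
    and "u \<in> I" "t * wedge f g u x = s * wedge f g y u"
  shows "bajraktarevic_mean I f g x y t s = u"
proof -
  have "g x * g y > 0"
    using nonzero_on_interval_same_sign assms by blast
  then have D: "t * g x + s * g y \<noteq> 0"
    using assms(7,8) by (smt (verit) zero_less_mult_iff mult_less_0_iff)
  have "f u / g u = (t * f x + s * f y) / (t * g x + s * g y)"
    using D assms(3)[OF \<open>u \<in> I\<close>] assms(10) unfolding wedge_def by (simp add: field_simps)
  then show ?thesis
    unfolding bajraktarevic_mean_def using assms by (metis (no_types, lifting) the_inv_into_f_eq)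
qed

text \<open>
  As \<open>g\<close> has constant sign, the quotient defining the mean is a convex combination of the values of
  \<open>f/g\<close> at \<open>x\<close> and \<open>y\<close>, so the intermediate value theorem provides a solution between \<open>x\<close> and \<open>y\<close>.
\<close>

lemma bajraktarevic_mean_props:
  assumes "is_interval I" "continuous_on I f" "continuous_on I g" "\<And>x. x \<in> I \<Longrightarrow> g x \<noteq> 0"
    and "inj_on (\<lambda>x. f x / g x) I" "x \<in> I" "y \<in> I" "t > 0" "s > 0"
  defines "u \<equiv> bajraktarevic_mean I f g x y t s"
  shows "u \<in> closed_segment x y" "u \<in> I" "t * wedge f g u x = s * wedge f g y u"
proof -
  let ?r = "\<lambda>x. f x / g x" and ?D = "t * g x + s * g y"
  have seg: "closed_segment x y \<subseteq> I"
    using closed_segment_subset_interval assms by blast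
  have gg: "g x * g y > 0"
    using nonzero_on_interval_same_sign assms by blast
  then have D: "?D \<noteq> 0" and "g x * ?D > 0" "g y * ?D > 0"
    using assms(8,9) by (smt (verit) zero_less_mult_iff mult_less_0_iff)+
  have nz: "g x \<noteq> 0" "g y \<noteq> 0" using gg by auto
  define l where "l = s * g y / ?D"
  have l: "0 \<le> l" "l \<le> 1"
  proof -
    have "l = s * (g y * ?D) / ?D\<^sup>2"
      unfolding l_def by (simp add: power2_eq_square)
    then show "0 \<le> l" using \<open>g y * ?D > 0\<close> assms(9) by simp
    have "1 - l = t * g x / ?D" unfolding l_def using D by (simp add: field_simps)
    also have "\<dots> = t * (g x * ?D) / ?D\<^sup>2" by (simp add: power2_eq_square)
    also have "\<dots> \<ge> 0" using \<open>g x * ?D > 0\<close> assms(8) by simp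
    finally show "l \<le> 1" by simp
  qed
  have "(t * f x + s * f y) / ?D = (1 - l) * ?r x + l * ?r y"
    unfolding l_def using D nz by (simp add: divide_simps)
  then have "(t * f x + s * f y) / ?D \<in> closed_segment (?r x) (?r y)"
    using l unfolding closed_segment_def by auto
  moreover have "is_interval (?r ` closed_segment x y)"
    unfolding is_interval_connected_1 using assms(2-4) seg
    by (intro connected_continuous_image continuous_on_divide) (auto intro: continuous_on_subset)
  ultimately have "(t * f x + s * f y) / ?D \<in> ?r ` closed_segment x y"
    using closed_segment_subset_interval[of "?r ` closed_segment x y" "?r x" "?r y"] by blast
  then obtain v where v: "v \<in> closed_segment x y" "?r v = (t * f x + s * f y) / ?D"
    by auto
  have "u = v"
    unfolding u_def bajraktarevic_mean_def using v seg assms(5)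
    by (metis (no_types, lifting) subsetD the_inv_into_f_eq)
  then show "u \<in> closed_segment x y" "u \<in> I" using v seg by auto
  then have "g u \<noteq> 0" using assms(4) by auto
  then show "t * wedge f g u x = s * wedge f g y u"
    using v(2) D unfolding \<open>u = v\<close> wedge_def by (simp add: field_simps)
qed

lemma wedge_linear_combination:
  assumes "h a = p * f a + q * g a" "k a = r * f a + s * g a"
    and "h b = p * f b + q * g b" "k b = r * f b + s * g b"
  shows "wedge h k b a = (p * s - q * r) * wedge f g b a"
  unfolding wedge_def assms by algebra

text \<open>
  By the addition theorem, the determinant depends on \<open>b - a\<close> only, so it is not changed when an
  interval is reflected to another one of the same length.
\<close>

lemma wedge_sin_cos_type: "wedge (sin_type p) (cos_type p) b a = sin_type p (b - a)"
  by (auto simp: wedge_def sin_type_def cos_type_def sin_diff sinh_diff algebra_simps)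

lemma wedge_scale: "wedge (\<lambda>x. f x * w x) (\<lambda>x. g x * w x) b a = w a * w b * wedge f g b a"
  by (simp add: wedge_def algebra_simps)

text \<open>
  The mean \<open>u\<close> of the first pair solves \<open>t S(u - x) / \<phi>(x) = s S(y - u) / \<phi>(y)\<close>.  The reflected point
  \<open>v = x + y - u\<close> satisfies \<open>v - x = y - u\<close> and \<open>y - v = u - x\<close>, so the same equation, multiplied by
  \<open>\<phi>(x) \<phi>(y)\<close>, reads \<open>s S(v - x) \<phi>(x) = t S(y - v) \<phi>(y)\<close>, which characterizes the mean of the second
  pair with exchanged weights.
\<close>

lemma invariance_of_sin_cos_type:
  assumes "is_interval I" and "\<And>x. x \<in> I \<Longrightarrow> \<phi> x > 0"
    and fg: "(f, g) \<in> reg_class 0 I" and hk: "(h, k) \<in> reg_class 0 I"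
    and eqf: "pair_equiv_on I (f, g) (\<lambda>x. sin_type p x / \<phi> x, \<lambda>x. cos_type p x / \<phi> x)"
    and eqh: "pair_equiv_on I (h, k) (\<lambda>x. sin_type p x * \<phi> x, \<lambda>x. cos_type p x * \<phi> x)"
    and st: "s > 0" "t > 0" and xy: "x \<in> I" "y \<in> I"
  shows "bajraktarevic_mean I f g x y t s + bajraktarevic_mean I h k x y s t = x + y"
proof -
  have inj: "inj_on (\<lambda>x. f x / g x) I" if "(f, g) \<in> reg_class 0 I" for f g
    using that unfolding reg_class_def
    by (auto simp: inj_on_def monotone_on_def) (metis linorder_less_linear order_less_irrefl)+
  define u where "u = bajraktarevic_mean I f g x y t s"
  have u: "u \<in> closed_segment x y" "u \<in> I" "t * wedge f g u x = s * wedge f g y u"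
    unfolding u_def using fg st xy assms(1)
    by (auto intro!: bajraktarevic_mean_props inj simp: reg_class_def)
  have seg: "x + y - u \<in> closed_segment x y"
    using u(1) by (auto simp: closed_segment_eq_real_ivl split: if_splits)
  then have v: "x + y - u \<in> I"
    using closed_segment_subset_interval[OF assms(1) xy] by blast
  obtain c where c: "c \<noteq> 0" "\<And>a b. a \<in> I \<Longrightarrow> b \<in> I \<Longrightarrow>
      sin_type p (b - a) / (\<phi> a * \<phi> b) = c * wedge f g b a"
  proof -
    obtain \<alpha> \<beta> \<gamma> \<delta> where *: "\<alpha> * \<delta> \<noteq> \<beta> * \<gamma>"
      "\<And>x. x \<in> I \<Longrightarrow> sin_type p x / \<phi> x = \<alpha> * f x + \<beta> * g x \<and>
          cos_type p x / \<phi> x = \<gamma> * f x + \<delta> * g x"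
      using eqf unfolding pair_equiv_on_def by auto
    have "sin_type p (b - a) / (\<phi> a * \<phi> b) = (\<alpha> * \<delta> - \<beta> * \<gamma>) * wedge f g b a"
      if "a \<in> I" "b \<in> I" for a b
      using wedge_linear_combination[of "\<lambda>x. sin_type p x / \<phi> x" a \<alpha> f \<beta> g "\<lambda>x. cos_type p x / \<phi> x" \<gamma> \<delta> b]
        * that wedge_scale[of "sin_type p" "\<lambda>x. inverse (\<phi> x)" "cos_type p" b a]
      by (simp add: wedge_sin_cos_type field_simps)
    with * that show ?thesis by (metis right_minus_eq)
  qed
  obtain d where d: "d \<noteq> 0" "\<And>a b. a \<in> I \<Longrightarrow> b \<in> I \<Longrightarrow>
      sin_type p (b - a) * (\<phi> a * \<phi> b) = d * wedge h k b a"
  proof -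
    obtain \<alpha> \<beta> \<gamma> \<delta> where *: "\<alpha> * \<delta> \<noteq> \<beta> * \<gamma>"
      "\<And>x. x \<in> I \<Longrightarrow> sin_type p x * \<phi> x = \<alpha> * h x + \<beta> * k x \<and>
          cos_type p x * \<phi> x = \<gamma> * h x + \<delta> * k x"
      using eqh unfolding pair_equiv_on_def by auto
    have "sin_type p (b - a) * (\<phi> a * \<phi> b) = (\<alpha> * \<delta> - \<beta> * \<gamma>) * wedge h k b a"
      if "a \<in> I" "b \<in> I" for a b
      using wedge_linear_combination[of "\<lambda>x. sin_type p x * \<phi> x" a \<alpha> h \<beta> k "\<lambda>x. cos_type p x * \<phi> x" \<gamma> \<delta> b]
        * that wedge_scale[of "sin_type p" \<phi> "cos_type p" b a]
      by (simp add: wedge_sin_cos_type field_simps)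
    with * that show ?thesis by (metis right_minus_eq)
  qed
  have pos: "\<phi> x > 0" "\<phi> y > 0" "\<phi> u > 0" "\<phi> (x + y - u) > 0"
    using assms(2) xy u(2) v by auto
  have "t * (c * wedge f g u x) = s * (c * wedge f g y u)"
    using u(3) by algebra
  then have "t * (sin_type p (u - x) / (\<phi> x * \<phi> u)) = s * (sin_type p (y - u) / (\<phi> u * \<phi> y))"
    by (simp add: c(2) xy u(2))
  then have "t * sin_type p (u - x) * \<phi> y = s * sin_type p (y - u) * \<phi> x"
    using pos by (simp add: field_simps)
  then have "s * (d * wedge h k (x + y - u) x) = t * (d * wedge h k y (x + y - u))"
    using xy v by (simp add: d(2)[symmetric])
  then have "bajraktarevic_mean I h k x y s t = x + y - u"
    using d(1) hk st xy assms(1) v inj[OF hk]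
    by (intro bajraktarevic_mean_eqI) (auto simp: reg_class_def)
  then show ?thesis by (simp add: u_def)
qed

section \<open>Pairs with Wronskian 1 and their local expansion\<close>

lemma eventually_shift_in_open:
  fixes I :: "real set"
  assumes "open I" "x \<in> I"
  shows "\<forall>\<^sub>F h in nhds 0. x + h \<in> I" "\<forall>\<^sub>F h in at 0. x + h \<in> I \<and> h \<noteq> 0"
proof -
  show ev: "\<forall>\<^sub>F h in nhds 0. x + h \<in> I"
    using eventually_nhds_in_open[OF open_vimage[OF assms(1), of "\<lambda>h. x + h"], of 0] assms(2)
    by (simp add: continuous_intros)
  then show "\<forall>\<^sub>F h in at 0. x + h \<in> I \<and> h \<noteq> 0"
    by (auto simp: eventually_at_filter elim: eventually_mono)
qed

text \<open>
  A Peano expansion may be integrated term by term; this is l'Hospital's rule.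
\<close>

lemma peano_antiderivative:
  fixes f :: "real \<Rightarrow> real"
  assumes D: "\<forall>\<^sub>F h in nhds 0. (f has_real_derivative f' h) (at h)" and "f 0 = 0"
    and L: "((\<lambda>h. f' h / h ^ n) \<longlongrightarrow> L) (at 0)"
  shows "((\<lambda>h. f h / h ^ Suc n) \<longlongrightarrow> L / real (Suc n)) (at 0)"
proof (rule lhopital)
  have "isCont f 0" using eventually_nhds_x_imp_x[OF D] by (rule DERIV_isCont)
  then show "(f \<longlongrightarrow> 0) (at 0)" using \<open>f 0 = 0\<close> by (simp add: isCont_def)
  show "((\<lambda>h. h ^ Suc n) \<longlongrightarrow> (0::real)) (at 0)"
    by (auto intro!: tendsto_eq_intros)
  show "\<forall>\<^sub>F h in at 0. h ^ Suc n \<noteq> (0::real)" "\<forall>\<^sub>F h in at 0. real (Suc n) * h ^ n \<noteq> 0"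
    by (rule eventually_mono[OF eventually_neq_at_within[of 0]], simp)+
  show "\<forall>\<^sub>F h in at 0. (f has_real_derivative f' h) (at h)"
    using D by (simp add: eventually_at_filter eventually_mono)
  show "\<forall>\<^sub>F h in at 0. ((\<lambda>h. h ^ Suc n) has_real_derivative real (Suc n) * h ^ n) (at h)"
    using DERIV_pow[of "Suc n"] by (simp del: power_Suc)
  have "((\<lambda>h. (f' h / h ^ n) / real (Suc n)) \<longlongrightarrow> L / real (Suc n)) (at 0)"
    by (intro tendsto_divide L tendsto_const) simp
  then show "((\<lambda>h. f' h / (real (Suc n) * h ^ n)) \<longlongrightarrow> L / real (Suc n)) (at 0)"
    by (simp add: mult.commute)
qed

text \<open>
  A fundamental system of the equation \<open>Y'' = P Y\<close> with Wronskian 1, together with its derivatives.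
  Up to a common factor and a sign, every pair of the regularity class has this form, and then the
  potential \<open>P\<close> encodes the pair up to equivalence.
\<close>

definition normal_pair ::
  "real set \<Rightarrow> (real \<Rightarrow> real) \<Rightarrow> (real \<Rightarrow> real) \<Rightarrow> (real \<Rightarrow> real) \<Rightarrow> (real \<Rightarrow> real) \<Rightarrow> (real \<Rightarrow> real) \<Rightarrow> bool"
  where
  "normal_pair I P F F' G G' \<longleftrightarrow>
     (\<forall>x\<in>I. (F has_real_derivative F' x) (at x) \<and> (F' has_real_derivative P x * F x) (at x) \<and>
        (G has_real_derivative G' x) (at x) \<and> (G' has_real_derivative P x * G x) (at x) \<and>
        F' x * G x - F x * G' x = 1)"

lemma normal_pairD:
  assumes "normal_pair I P F F' G G'" "x \<in> I"
  shows "(F has_real_derivative F' x) (at x)" "(F' has_real_derivative P x * F x) (at x)"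
    "(G has_real_derivative G' x) (at x)" "(G' has_real_derivative P x * G x) (at x)"
    "F' x * G x - F x * G' x = 1"
  using assms unfolding normal_pair_def by auto

text \<open>
  The sine-like and the cosine-like solution at \<open>x\<close>.  The differential
  equation turns the derivatives of \<open>P\<close> and \<open>Y\<close> at \<open>x\<close> into an expansion of \<open>Y''\<close>, which is integrated
  twice.
\<close>

lemma peano_of_potential:
  fixes Y Y' P :: "real \<Rightarrow> real"
  assumes "open I" "x \<in> I"
    and Y: "\<And>y. y \<in> I \<Longrightarrow> (Y has_real_derivative Y' y) (at y)"
    and Y': "\<And>y. y \<in> I \<Longrightarrow> (Y' has_real_derivative P y * Y y) (at y)"
    and P: "(P has_real_derivative p1) (at x)"
  shows "Y x = 0 \<Longrightarrow> Y' x = 1 \<Longrightarrow>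
          ((\<lambda>h. (Y (x + h) - h - P x * h ^ 3 / 6) / h ^ 4) \<longlongrightarrow> p1 / 12) (at 0)"
    and "Y x = 1 \<Longrightarrow> Y' x = 0 \<Longrightarrow>
          ((\<lambda>h. (Y (x + h) - 1 - P x * h\<^sup>2 / 2) / h ^ 3) \<longlongrightarrow> p1 / 6) (at 0)"
proof -
  note ev = eventually_shift_in_open(1)[OF assms(1,2)]
  have DY: "((\<lambda>h. Y (x + h)) has_real_derivative Y' (x + h)) (at h)" if "x + h \<in> I" for h
    using DERIV_shift[of Y "Y' (x + h)" h x] Y[OF that] by (simp add: add.commute)
  have DY': "((\<lambda>h. Y' (x + h)) has_real_derivative P (x + h) * Y (x + h)) (at h)" if "x + h \<in> I" for h
    using DERIV_shift[of Y' "P (x + h) * Y (x + h)" h x] Y'[OF that] by (simp add: add.commute)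
  have quot: "((\<lambda>h. (f (x + h) - f x) / h) \<longlongrightarrow> d) (at 0)" if "(f has_real_derivative d) (at x)"
    for f :: "real \<Rightarrow> real" and d
    using that by (simp add: DERIV_def)
  {
    assume 0: "Y x = 0" "Y' x = 1"
    have "((\<lambda>h. (Y' (x + h) - 1) / h ^ 1) \<longlongrightarrow> 0) (at 0)"
      using quot[OF Y'[OF assms(2)]] 0 by simp
    then have Y2: "((\<lambda>h. (Y (x + h) - h) / h ^ Suc 1) \<longlongrightarrow> 0 / real (Suc 1)) (at 0)"
      by (rule peano_antiderivative[rotated 2])
         (use 0 in \<open>auto intro!: eventually_mono[OF ev] derivative_eq_intros DY\<close>)
    have "((\<lambda>h. (P (x + h) - P x) / h * (Y (x + h) / h) + P x * ((Y (x + h) - h) / h ^ 2))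
            \<longlongrightarrow> p1 * 1 + P x * 0) (at 0)"
      using quot[OF P] quot[OF Y[OF assms(2)]] Y2 0
      by (intro tendsto_intros) (simp_all add: numeral_2_eq_2)
    then have "((\<lambda>h. (P (x + h) * Y (x + h) - P x * h) / h ^ 2) \<longlongrightarrow> p1 * 1 + P x * 0) (at 0)"
      by (rule Lim_transform_eventually)
         (auto simp: eventually_at_filter field_simps power2_eq_square)
    then have "((\<lambda>h. (Y' (x + h) - 1 - P x * h ^ 2 / 2) / h ^ Suc 2) \<longlongrightarrow> p1 / real (Suc 2)) (at 0)"
      by (intro peano_antiderivative)
         (use 0 in \<open>auto intro!: eventually_mono[OF ev] derivative_eq_intros DY'\<close>)
    then have "((\<lambda>h. (Y (x + h) - h - P x * h ^ 3 / 6) / h ^ Suc (Suc 2)) \<longlongrightarrow>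
                 p1 / real (Suc 2) / real (Suc (Suc 2))) (at 0)"
      by (rule peano_antiderivative[rotated 2])
         (use 0 in \<open>auto intro!: eventually_mono[OF ev] derivative_eq_intros DY\<close>)
    then show "((\<lambda>h. (Y (x + h) - h - P x * h ^ 3 / 6) / h ^ 4) \<longlongrightarrow> p1 / 12) (at 0)"
      by (simp add: numeral_eq_Suc)
  }
  {
    assume 0: "Y x = 1" "Y' x = 0"
    have "((\<lambda>y. P y * Y y) has_real_derivative p1) (at x)"
      using P Y[OF assms(2)] 0 by (auto intro!: derivative_eq_intros)
    from quot[OF this] have "((\<lambda>h. (P (x + h) * Y (x + h) - P x) / h ^ 1) \<longlongrightarrow> p1) (at 0)"
      using 0 by simp
    then have "((\<lambda>h. (Y' (x + h) - P x * h) / h ^ Suc 1) \<longlongrightarrow> p1 / real (Suc 1)) (at 0)"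
      by (rule peano_antiderivative[rotated 2])
         (use 0 in \<open>auto intro!: eventually_mono[OF ev] derivative_eq_intros DY'\<close>)
    then have "((\<lambda>h. (Y (x + h) - 1 - P x * h\<^sup>2 / 2) / h ^ Suc (Suc 1)) \<longlongrightarrow>
                 p1 / real (Suc 1) / real (Suc (Suc 1))) (at 0)"
      by (rule peano_antiderivative[rotated 2])
         (use 0 in \<open>auto intro!: eventually_mono[OF ev] derivative_eq_intros DY\<close>)
    then show "((\<lambda>h. (Y (x + h) - 1 - P x * h\<^sup>2 / 2) / h ^ 3) \<longlongrightarrow> p1 / 6) (at 0)"
      by (simp add: numeral_eq_Suc)
  }
qed

text \<open>
  The determinant of a normal pair at two nearby points is \<open>l + P(c) l\<^sup>3 / 6 + o(l\<^sup>4)\<close>, where \<open>l\<close>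
  is their difference and \<open>c\<close> their midpoint.  Here the points are \<open>x + \<epsilon> a(\<epsilon>)\<close> and \<open>x + \<epsilon> b(\<epsilon>)\<close>, and \<open>P(c)\<close> is
  expanded at \<open>x\<close>, which makes \<open>P' (b - a)\<^sup>3 (a + b) / 12\<close> the coefficient of \<open>\<epsilon>\<^sup>4\<close>.  Referring everything to
  the fixed point \<open>x\<close> avoids uniform estimates: it suffices to know the expansions of two solutions
  at \<open>x\<close>.
\<close>

lemma wedge_expansion:
  assumes "open I" "x \<in> I" "normal_pair I P F F' G G'" "(P has_real_derivative p1) (at x)"
    and a: "(a \<longlongrightarrow> A) (at 0)" and b: "(b \<longlongrightarrow> B) (at (0::real))"
  obtains K where "(K \<longlongrightarrow> p1 * (B - A) ^ 3 * (A + B) / 12) (at 0)"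
    and "\<And>\<epsilon>. wedge F G (x + \<epsilon> * b \<epsilon>) (x + \<epsilon> * a \<epsilon>) =
           \<epsilon> * (b \<epsilon> - a \<epsilon>) + P x * (\<epsilon> * (b \<epsilon> - a \<epsilon>)) ^ 3 / 6 + \<epsilon> ^ 4 * K \<epsilon>"
proof -
  note * = normal_pairD[OF assms(3)]
  \<comment> \<open>The solutions with initial values \<open>(0, 1)\<close> and \<open>(1, 0)\<close> at \<open>x\<close>; the change of basis has determinant 1.\<close>
  define S where "S y = G x * F y - F x * G y" for y
  define C where "C y = F' x * G y - G' x * F y" for y
  have WSC: "wedge F G u v = wedge S C u v" for u v
    using *(5)[OF \<open>x \<in> I\<close>] unfolding wedge_def S_def C_def by algebra
  have "((\<lambda>h. (S (x + h) - h - P x * h ^ 3 / 6) / h ^ 4) \<longlongrightarrow> p1 / 12) (at 0)"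
    by (rule peano_of_potential(1)[where Y' = "\<lambda>y. G x * F' y - F x * G' y", OF assms(1,2)])
       (use *(1-4) *(5)[OF \<open>x \<in> I\<close>] assms(2,4) in \<open>auto simp: S_def algebra_simps intro!: derivative_eq_intros\<close>)
  then obtain TS where TS: "isCont TS 0" "TS 0 = p1 / 12"
      "\<And>h. h \<noteq> 0 \<Longrightarrow> TS h = (S (x + h) - h - P x * h ^ 3 / 6) / h ^ 4"
    by (intro that[of "\<lambda>h. if h = 0 then p1 / 12 else (S (x + h) - h - P x * h ^ 3 / 6) / h ^ 4"])
       (auto simp: isCont_def eventually_at_filter elim: Lim_transform_eventually)
  have "((\<lambda>h. (C (x + h) - 1 - P x * h\<^sup>2 / 2) / h ^ 3) \<longlongrightarrow> p1 / 6) (at 0)"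
    by (rule peano_of_potential(2)[where Y' = "\<lambda>y. F' x * G' y - G' x * F' y", OF assms(1,2)])
       (use *(1-4) *(5)[OF \<open>x \<in> I\<close>] assms(2,4) in \<open>auto simp: C_def algebra_simps intro!: derivative_eq_intros\<close>)
  then obtain TC where TC: "isCont TC 0" "TC 0 = p1 / 6"
      "\<And>h. h \<noteq> 0 \<Longrightarrow> TC h = (C (x + h) - 1 - P x * h\<^sup>2 / 2) / h ^ 3"
    by (intro that[of "\<lambda>h. if h = 0 then p1 / 6 else (C (x + h) - 1 - P x * h\<^sup>2 / 2) / h ^ 3"])
       (auto simp: isCont_def eventually_at_filter elim: Lim_transform_eventually)
  have S: "S (x + h) = h + P x * h ^ 3 / 6 + h ^ 4 * TS h" for h
    using TS(3)[of h] by (cases "h = 0") (auto simp: S_def field_simps)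
  have C: "C (x + h) = 1 + P x * h\<^sup>2 / 2 + h ^ 3 * TC h" for h
    using TC(3)[of h] *(5)[OF \<open>x \<in> I\<close>] by (cases "h = 0") (auto simp: C_def field_simps)
  have lim0: "((\<lambda>\<epsilon>. \<epsilon> * c \<epsilon>) \<longlongrightarrow> 0) (at 0)" if "(c \<longlongrightarrow> l) (at 0)" for c :: "real \<Rightarrow> real" and l
    using tendsto_mult[OF tendsto_ident_at that] by simp
  have T: "((\<lambda>\<epsilon>. TS (\<epsilon> * a \<epsilon>)) \<longlongrightarrow> p1 / 12) (at 0)" "((\<lambda>\<epsilon>. TS (\<epsilon> * b \<epsilon>)) \<longlongrightarrow> p1 / 12) (at 0)"
      "((\<lambda>\<epsilon>. TC (\<epsilon> * a \<epsilon>)) \<longlongrightarrow> p1 / 6) (at 0)" "((\<lambda>\<epsilon>. TC (\<epsilon> * b \<epsilon>)) \<longlongrightarrow> p1 / 6) (at 0)"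
    using isCont_tendsto_compose[OF TS(1) lim0[OF a]] isCont_tendsto_compose[OF TS(1) lim0[OF b]]
      isCont_tendsto_compose[OF TC(1) lim0[OF a]] isCont_tendsto_compose[OF TC(1) lim0[OF b]]
    by (simp_all add: TS(2) TC(2))
  \<comment> \<open>The exact remainder after division by \<open>\<epsilon>\<^sup>4\<close>, as a polynomial in \<open>\<epsilon>\<close>, the positions
    \<open>\<alpha>\<close>, \<open>\<beta>\<close> and the Taylor remainders of \<open>S\<close> and \<open>C\<close> at the two points.\<close>
  define E where "E \<epsilon> \<alpha> \<beta> s\<^sub>a s\<^sub>b c\<^sub>a c\<^sub>b =
      \<beta> ^ 4 * s\<^sub>b - \<alpha> ^ 4 * s\<^sub>a + \<beta> * \<alpha> ^ 3 * c\<^sub>a - \<alpha> * \<beta> ^ 3 * c\<^sub>b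
      + \<epsilon> * (P x)\<^sup>2 / 12 * (\<beta> ^ 3 * \<alpha>\<^sup>2 - \<alpha> ^ 3 * \<beta>\<^sup>2)
      + \<epsilon>\<^sup>2 * P x / 6 * \<alpha> ^ 3 * \<beta> ^ 3 * (c\<^sub>a - c\<^sub>b)
      + \<epsilon>\<^sup>2 * P x / 2 * (\<beta> ^ 4 * \<alpha>\<^sup>2 * s\<^sub>b - \<alpha> ^ 4 * \<beta>\<^sup>2 * s\<^sub>a)
      + \<epsilon> ^ 3 * (\<beta> ^ 4 * \<alpha> ^ 3 * s\<^sub>b * c\<^sub>a - \<alpha> ^ 4 * \<beta> ^ 3 * s\<^sub>a * c\<^sub>b)" for \<epsilon> \<alpha> \<beta> s\<^sub>a s\<^sub>b c\<^sub>a c\<^sub>b :: real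
  define K where "K \<epsilon> = E \<epsilon> (a \<epsilon>) (b \<epsilon>) (TS (\<epsilon> * a \<epsilon>)) (TS (\<epsilon> * b \<epsilon>)) (TC (\<epsilon> * a \<epsilon>)) (TC (\<epsilon> * b \<epsilon>))"
    for \<epsilon>
  have "(K \<longlongrightarrow> E 0 A B (p1 / 12) (p1 / 12) (p1 / 6) (p1 / 6)) (at 0)"
    unfolding K_def E_def by (intro tendsto_intros a b T) simp_all
  moreover have "E 0 A B (p1 / 12) (p1 / 12) (p1 / 6) (p1 / 6) = p1 * (B - A) ^ 3 * (A + B) / 12"
    by (simp add: E_def field_simps eval_nat_numeral)
  moreover have "wedge F G (x + \<epsilon> * b \<epsilon>) (x + \<epsilon> * a \<epsilon>) =
      \<epsilon> * (b \<epsilon> - a \<epsilon>) + P x * (\<epsilon> * (b \<epsilon> - a \<epsilon>)) ^ 3 / 6 + \<epsilon> ^ 4 * K \<epsilon>" for \<epsilon>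
  proof -
    have id: "(\<epsilon> * \<beta> + p * (\<epsilon> * \<beta>) ^ 3 / 6 + (\<epsilon> * \<beta>) ^ 4 * s\<^sub>b) * (1 + p * (\<epsilon> * \<alpha>)\<^sup>2 / 2 + (\<epsilon> * \<alpha>) ^ 3 * c\<^sub>a)
        - (\<epsilon> * \<alpha> + p * (\<epsilon> * \<alpha>) ^ 3 / 6 + (\<epsilon> * \<alpha>) ^ 4 * s\<^sub>a) * (1 + p * (\<epsilon> * \<beta>)\<^sup>2 / 2 + (\<epsilon> * \<beta>) ^ 3 * c\<^sub>b)
      = \<epsilon> * (\<beta> - \<alpha>) + p * (\<epsilon> * (\<beta> - \<alpha>)) ^ 3 / 6 +
      \<epsilon> ^ 4 * (\<beta> ^ 4 * s\<^sub>b - \<alpha> ^ 4 * s\<^sub>a + \<beta> * \<alpha> ^ 3 * c\<^sub>a - \<alpha> * \<beta> ^ 3 * c\<^sub>b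
      + \<epsilon> * p\<^sup>2 / 12 * (\<beta> ^ 3 * \<alpha>\<^sup>2 - \<alpha> ^ 3 * \<beta>\<^sup>2)
      + \<epsilon>\<^sup>2 * p / 6 * \<alpha> ^ 3 * \<beta> ^ 3 * (c\<^sub>a - c\<^sub>b)
      + \<epsilon>\<^sup>2 * p / 2 * (\<beta> ^ 4 * \<alpha>\<^sup>2 * s\<^sub>b - \<alpha> ^ 4 * \<beta>\<^sup>2 * s\<^sub>a)
      + \<epsilon> ^ 3 * (\<beta> ^ 4 * \<alpha> ^ 3 * s\<^sub>b * c\<^sub>a - \<alpha> ^ 4 * \<beta> ^ 3 * s\<^sub>a * c\<^sub>b))"
      for p \<alpha> \<beta> s\<^sub>a s\<^sub>b c\<^sub>a c\<^sub>b :: real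
      by (simp add: field_simps eval_nat_numeral)
    show ?thesis
      unfolding WSC unfolding wedge_def S C K_def E_def by (rule id)
  qed
  ultimately show ?thesis using that by auto
qed

section \<open>Linear second-order equations with a common potential\<close>

lemma interval_zero_derivative_constant:
  fixes f :: "real \<Rightarrow> real"
  assumes "is_interval I" "\<And>x. x \<in> I \<Longrightarrow> (f has_real_derivative 0) (at x)"
  obtains c where "\<And>x. x \<in> I \<Longrightarrow> f x = c"
proof -
  have "\<exists>c. \<forall>x\<in>I. f x = c"
    using assms by (intro has_field_derivative_zero_constant)
      (auto simp: is_interval_convex_1 intro: has_field_derivative_at_within)
  with that show ?thesis by blast
qed

text \<open>
  The coefficients are the Wronskians of \<open>Y\<close> with \<open>F\<close> and \<open>G\<close>, which are constant because both
  functions satisfy the same equation.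
\<close>

lemma solution_in_span_of_normal_pair:
  assumes "is_interval I" "normal_pair I P F F' G G'"
    and Y: "\<And>x. x \<in> I \<Longrightarrow> (Y has_real_derivative Y' x) (at x)"
    and Y': "\<And>x. x \<in> I \<Longrightarrow> (Y' has_real_derivative P x * Y x) (at x)"
  obtains \<alpha> \<beta> where "\<And>x. x \<in> I \<Longrightarrow> Y x = \<alpha> * F x + \<beta> * G x \<and> Y' x = \<alpha> * F' x + \<beta> * G' x"
proof -
  note * = normal_pairD[OF assms(2)]
  have "((\<lambda>x. Y' x * G x - Y x * G' x) has_real_derivative 0) (at x)" if "x \<in> I" for x
    by (rule DERIV_cong[OF DERIV_diff[OF DERIV_mult[OF Y'[OF that] *(3)[OF that]]
          DERIV_mult[OF Y[OF that] *(4)[OF that]]]]) (simp add: algebra_simps)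
  then obtain \<alpha> where \<alpha>: "\<And>x. x \<in> I \<Longrightarrow> Y' x * G x - Y x * G' x = \<alpha>"
    using interval_zero_derivative_constant[OF assms(1), of "\<lambda>x. Y' x * G x - Y x * G' x"] by blast
  have "((\<lambda>x. F' x * Y x - F x * Y' x) has_real_derivative 0) (at x)" if "x \<in> I" for x
    by (rule DERIV_cong[OF DERIV_diff[OF DERIV_mult[OF *(2)[OF that] Y[OF that]]
          DERIV_mult[OF *(1)[OF that] Y'[OF that]]]]) (simp add: algebra_simps)
  then obtain \<beta> where \<beta>: "\<And>x. x \<in> I \<Longrightarrow> F' x * Y x - F x * Y' x = \<beta>"
    using interval_zero_derivative_constant[OF assms(1), of "\<lambda>x. F' x * Y x - F x * Y' x"] by blast
  have "Y x = \<alpha> * F x + \<beta> * G x \<and> Y' x = \<alpha> * F' x + \<beta> * G' x" if "x \<in> I" for x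
  proof -
    have "Y x * (F' x * G x - F x * G' x) = \<alpha> * F x + \<beta> * G x"
      "Y' x * (F' x * G x - F x * G' x) = \<alpha> * F' x + \<beta> * G' x"
      unfolding \<alpha>[OF that, symmetric] \<beta>[OF that, symmetric] by (simp_all add: algebra_simps)
    then show ?thesis using *(5)[OF that] by simp
  qed
  then show ?thesis using that by blast
qed

lemma normal_pairs_equivalent:
  assumes "is_interval I" "I \<noteq> {}" "normal_pair I P F F' G G'" "normal_pair I P S S' C C'"
  obtains \<alpha> \<beta> \<gamma> \<delta> where "\<forall>x\<in>I. S x = \<alpha> * F x + \<beta> * G x \<and> C x = \<gamma> * F x + \<delta> * G x"
    and "\<alpha> * \<delta> - \<beta> * \<gamma> = 1"
proof -
  note * = normal_pairD[OF assms(4)]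
  obtain \<alpha> \<beta> where S: "\<And>x. x \<in> I \<Longrightarrow> S x = \<alpha> * F x + \<beta> * G x \<and> S' x = \<alpha> * F' x + \<beta> * G' x"
    using solution_in_span_of_normal_pair[OF assms(1,3) *(1,2)] by blast
  obtain \<gamma> \<delta> where C: "\<And>x. x \<in> I \<Longrightarrow> C x = \<gamma> * F x + \<delta> * G x \<and> C' x = \<gamma> * F' x + \<delta> * G' x"
    using solution_in_span_of_normal_pair[OF assms(1,3) *(3,4)] by blast
  obtain x where x: "x \<in> I" using assms(2) by blast
  have "\<alpha> * \<delta> - \<beta> * \<gamma> = 1"
    using S[OF x] C[OF x] *(5)[OF x] normal_pairD(5)[OF assms(3) x] by algebra
  then show ?thesis using S C by (intro that) auto
qed

text \<open>
  The sine type function has slope \<open>\<surd>\<bar>p\<bar>\<close> at 0 (or 1 if \<open>p = 0\<close>) and has to be rescaled to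
  make the Wronskian 1.
\<close>

lemma sin_cos_type_normal_pair:
  obtains \<kappa> S' C' where "\<kappa> \<noteq> 0" "normal_pair I (\<lambda>x. p) (\<lambda>x. sin_type p x / \<kappa>) S' (cos_type p) C'"
proof -
  consider "p < 0" | "p = 0" | "p > 0" by linarith
  then show ?thesis
  proof cases
    case 1
    define r where "r = sqrt (- p)"
    have r: "r \<noteq> 0" "p = - (r * r)" using 1 by (simp_all add: r_def)
    have "sin_type p = (\<lambda>x. sin (r * x))" "cos_type p = (\<lambda>x. cos (r * x))"
      using 1 by (auto simp: sin_type_def cos_type_def r_def)
    with r show ?thesis
      by (intro that[of r "\<lambda>x. cos (r * x)" "\<lambda>x. - r * sin (r * x)"])
         (auto simp: normal_pair_def power2_eq_square[symmetric] intro!: derivative_eq_intros,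
          simp_all add: power2_eq_square)
  next
    case 2
    then have "sin_type p = (\<lambda>x. x)" "cos_type p = (\<lambda>x. 1)"
      by (auto simp: sin_type_def cos_type_def)
    with 2 show ?thesis
      by (intro that[of 1 "\<lambda>x. 1" "\<lambda>x. 0"])
         (auto simp: normal_pair_def intro!: derivative_eq_intros)
  next
    case 3
    define r where "r = sqrt p"
    have r: "r \<noteq> 0" "p = r * r" using 3 by (simp_all add: r_def)
    have "sin_type p = (\<lambda>x. sinh (r * x))" "cos_type p = (\<lambda>x. cosh (r * x))"
      using 3 by (auto simp: sin_type_def cos_type_def r_def)
    with r show ?thesis
      by (intro that[of r "\<lambda>x. cosh (r * x)" "\<lambda>x. r * sinh (r * x)"])
         (auto simp: normal_pair_def power2_eq_square[symmetric] hyperbolic_pythagoras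
           intro!: derivative_eq_intros, simp_all add: power2_eq_square)
  qed
qed

lemma times_cont_diff_on_constant_potential:
  assumes "open I" "\<And>x. x \<in> I \<Longrightarrow> (Y has_real_derivative Y' x) (at x)"
    and "\<And>x. x \<in> I \<Longrightarrow> (Y' has_real_derivative p * Y x) (at x)"
  shows "times_cont_diff_on n Y I"
proof -
  have "times_cont_diff_on n Y I \<and> times_cont_diff_on n Y' I"
  proof (induction n)
    case 0
    then show ?case using assms(2,3)
      by (auto simp: times_cont_diff_on_0 intro!: continuous_at_imp_continuous_on DERIV_isCont)
  next
    case (Suc n)
    have "times_cont_diff_on n (\<lambda>x. p * Y x) I"
      using Suc times_cont_diff_on_mult times_cont_diff_on_const assms(1) by blast
    then show ?case
      using Suc times_cont_diff_on_SucI[OF assms(1), of Y Y' n]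
        times_cont_diff_on_SucI[OF assms(1), of Y' "\<lambda>x. p * Y x" n] assms(2,3) by simp
  qed
  then show ?thesis by blast
qed

section \<open>Normal form of a pair and slope of its mean\<close>

text \<open>
  By the quotient rule, the derivative of \<open>f/g\<close> is nonzero exactly where the Wronskian is; injectivity
  of \<open>f/g\<close> then follows from Rolle's theorem.
\<close>

lemma reg_class_4D:
  assumes "open I" "is_interval I" "(f, g) \<in> reg_class 4 I"
  shows "times_cont_diff_on 4 f I" "times_cont_diff_on 4 g I" "\<And>x. x \<in> I \<Longrightarrow> g x \<noteq> 0"
    and "\<And>x. x \<in> I \<Longrightarrow> (f has_real_derivative deriv f x) (at x)"
    and "\<And>x. x \<in> I \<Longrightarrow> (g has_real_derivative deriv g x) (at x)"
    and "\<And>x. x \<in> I \<Longrightarrow> deriv f x * g x - f x * deriv g x \<noteq> 0"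
    and "inj_on (\<lambda>x. f x / g x) I"
proof -
  show 1: "times_cont_diff_on 4 f I" "times_cont_diff_on 4 g I"
    and g: "\<And>x. x \<in> I \<Longrightarrow> g x \<noteq> 0"
    using assms(3) by (auto simp: reg_class_def)
  have d: "\<And>x. x \<in> I \<Longrightarrow> deriv (\<lambda>x. f x / g x) x \<noteq> 0"
    using assms(3) by (auto simp: reg_class_def)
  have "times_cont_diff_on (Suc 3) f I" "times_cont_diff_on (Suc 3) g I"
    using 1 by simp_all
  then show D: "\<And>x. x \<in> I \<Longrightarrow> (f has_real_derivative deriv f x) (at x)"
     "\<And>x. x \<in> I \<Longrightarrow> (g has_real_derivative deriv g x) (at x)"
    using has_derivative_deriv_of_differentiable_on[OF assms(1)] times_cont_diff_on_Suc by blast+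
  have q: "((\<lambda>x. f x / g x) has_real_derivative
      (deriv f x * g x - f x * deriv g x) / (g x * g x)) (at x)" if "x \<in> I" for x
    using D[OF that] g[OF that] by (rule DERIV_divide)
  show "deriv f x * g x - f x * deriv g x \<noteq> 0" if "x \<in> I" for x
    using DERIV_imp_deriv[OF q[OF that]] d[OF that] by auto
  show "inj_on (\<lambda>x. f x / g x) I"
  proof (rule linorder_inj_onI')
    fix a b assume ab: "a \<in> I" "b \<in> I" "a < b"
    have I: "{a..b} \<subseteq> I"
      using closed_segment_subset_interval[OF assms(2) ab(1,2)] ab(3) by (simp add: closed_segment_eq_real_ivl)
    show "f a / g a \<noteq> f b / g b"
    proof
      assume eq: "f a / g a = f b / g b"
      have "continuous_on {a..b} (\<lambda>x. f x / g x)"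
        using I q by (intro continuous_at_imp_continuous_on) (blast intro: DERIV_isCont)
      moreover have "(\<lambda>x. f x / g x) differentiable (at x)" if "a < x" "x < b" for x
      proof -
        have "x \<in> I" using I that by auto
        then show ?thesis using q real_differentiable_def by blast
      qed
      ultimately obtain z where z: "a < z" "z < b" "((\<lambda>x. f x / g x) has_real_derivative 0) (at z)"
        using Rolle[OF ab(3) eq] by blast
      have "z \<in> I" using I z(1,2) by auto
      then show False
        using d DERIV_imp_deriv[OF z(3)] by blast
    qed
  qed
qed

text \<open>
  Dividing both functions by \<open>w = \<surd>\<bar>f' g - f g'\<bar>\<close>, and changing the sign of \<open>f\<close> if necessary, makes the
  Wronskian 1.  Differentiating the relation \<open>F' G - F G' = 1\<close> gives \<open>F'' G = F G''\<close>, and as \<open>G\<close> has no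
  zeros, both functions solve the equation with potential \<open>P = G'' / G\<close>.  Since \<open>w\<close> is three times
  differentiable, so is \<open>G\<close>, whence \<open>P\<close> is differentiable.
\<close>

lemma normal_form_exists:
  assumes "open I" "is_interval I" "(f, g) \<in> reg_class 4 I"
  obtains e P F F' G G' w where "e * e = (1::real)" "normal_pair I P F F' G G'"
    and "\<forall>x\<in>I. w x > 0 \<and> f x = e * w x * F x \<and> g x = w x * G x"
    and "P differentiable_on I"
proof (cases "I = {}")
  case True
  then show ?thesis using that[of 1 "\<lambda>x. 0" _ _ _ _ "\<lambda>x. 0"] by (simp add: normal_pair_def)
next
  case False
  then obtain x0 where x0: "x0 \<in> I" by blast
  note R = reg_class_4D[OF assms]
  define V where "V x = deriv f x * g x - f x * deriv g x" for x
  define e where "e = sgn (V x0)"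
  have "times_cont_diff_on (Suc 3) f I" "times_cont_diff_on (Suc 3) g I"
    using R(1,2) by simp_all
  then have fg3: "times_cont_diff_on 3 f I" "times_cont_diff_on 3 g I"
      "times_cont_diff_on 3 (deriv f) I" "times_cont_diff_on 3 (deriv g) I"
    using times_cont_diff_on_pred[OF assms(1)] times_cont_diff_on_Suc by blast+
  have V3: "times_cont_diff_on 3 V I"
    unfolding V_def by (intro times_cont_diff_on_diff times_cont_diff_on_mult fg3 assms(1))
  have V: "V x \<noteq> 0" if "x \<in> I" for x using R(6)[OF that] by (simp add: V_def)
  have e: "e * e = 1" using V[OF x0] by (simp add: e_def sgn_if)
  have eV: "e * V x > 0" if "x \<in> I" for x
  proof -
    have "V x0 * V x > 0"
      using times_cont_diff_on_imp_continuous_on[OF assms(1) V3]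
      by (intro nonzero_on_interval_same_sign[OF assms(2)] V x0 that) auto
    then show ?thesis by (auto simp: e_def sgn_if zero_less_mult_iff)
  qed
  define w where "w x = sqrt (e * V x)" for x
  have w: "w x > 0" if "x \<in> I" for x using eV[OF that] by (simp add: w_def)
  have w3: "times_cont_diff_on 3 w I"
    unfolding w_def
    by (intro times_cont_diff_on_sqrt times_cont_diff_on_mult times_cont_diff_on_const V3 assms(1) eV)
  define F where "F x = e * f x / w x" for x
  define G where "G x = g x / w x" for x
  have F3: "times_cont_diff_on (Suc 2) F I" and G3: "times_cont_diff_on (Suc (Suc 1)) G I"
    using w[THEN less_imp_neq] fg3 w3 unfolding F_def G_def
    by (auto intro!: times_cont_diff_on_divide times_cont_diff_on_mult times_cont_diff_on_const assms(1)
       simp: numeral_3_eq_3[symmetric] numeral_2_eq_2[symmetric])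
  note Dderiv = has_derivative_deriv_of_differentiable_on[OF assms(1)]
  have F: "(F has_real_derivative deriv F x) (at x)"
      "(deriv F has_real_derivative deriv (deriv F) x) (at x)" if "x \<in> I" for x
    using F3 that unfolding numeral_2_eq_2 times_cont_diff_on_Suc by (auto intro: Dderiv)
  have G: "(G has_real_derivative deriv G x) (at x)"
      "(deriv G has_real_derivative deriv (deriv G) x) (at x)" if "x \<in> I" for x
    using G3 that unfolding times_cont_diff_on_Suc by (auto intro: Dderiv)
  have wd: "w differentiable_on I"
    using w3 by (simp add: numeral_3_eq_3 times_cont_diff_on_Suc)
  have W: "deriv F x * G x - F x * deriv G x = 1" if x: "x \<in> I" for x
  proof -
    have DF: "deriv F x = (e * deriv f x * w x - e * f x * deriv w x) / (w x * w x)"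
      unfolding F_def using w[OF x]
      by (intro DERIV_imp_deriv DERIV_divide DERIV_cmult R(4)[OF x] Dderiv[OF wd x]) simp
    have DG: "deriv G x = (deriv g x * w x - g x * deriv w x) / (w x * w x)"
      unfolding G_def using w[OF x]
      by (intro DERIV_imp_deriv DERIV_divide R(5)[OF x] Dderiv[OF wd x]) simp
    have w2: "w x * w x = e * V x" using eV[OF x] by (simp add: w_def)
    have "deriv F x * G x - F x * deriv G x = e * V x / (w x * w x)"
      using w[OF x] unfolding DF DG F_def G_def V_def by (simp add: field_simps)
    then show ?thesis unfolding w2 using eV[OF x] by auto
  qed
  have Gnz: "G x \<noteq> 0" if "x \<in> I" for x
    using R(3)[OF that] w[OF that] by (simp add: G_def)
  define P where "P x = deriv (deriv G) x / G x" for x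
  have FP: "deriv (deriv F) x = P x * F x" if x: "x \<in> I" for x
  proof -
    have "((\<lambda>x. deriv F x * G x - F x * deriv G x) has_real_derivative
       (deriv (deriv F) x * G x + deriv G x * deriv F x)
       - (deriv F x * deriv G x + deriv (deriv G) x * F x)) (at x)"
      by (intro DERIV_diff DERIV_mult F G x)
    moreover have "((\<lambda>x. deriv F x * G x - F x * deriv G x) has_real_derivative 0) (at x)"
      by (rule has_field_derivative_transform_within_open[OF DERIV_const[of 1] assms(1) x]) (simp add: W)
    ultimately have "deriv (deriv F) x * G x = deriv (deriv G) x * F x"
      using DERIV_unique by fastforce
    then show ?thesis using Gnz[OF x] by (simp add: P_def field_simps)
  qed
  have "times_cont_diff_on (Suc 0) P I"
    unfolding P_def
  proof (rule times_cont_diff_on_divide[OF assms(1) _ _ Gnz])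
    show "times_cont_diff_on (Suc 0) (deriv (deriv G)) I" "times_cont_diff_on (Suc 0) G I"
      using G3 times_cont_diff_on_pred[OF assms(1)] by (auto simp: times_cont_diff_on_Suc)
  qed
  then have Pd: "P differentiable_on I" by (simp add: times_cont_diff_on_Suc)
  have "normal_pair I P F (deriv F) G (deriv G)"
    unfolding normal_pair_def using F G W FP Gnz by (simp add: P_def)
  moreover have "f x = e * w x * F x" "g x = w x * G x" if "x \<in> I" for x
    using w[OF that] e by (simp_all add: F_def G_def)
  ultimately show ?thesis
    using e w Pd by (intro that[of e P F "deriv F" G "deriv G" w]) auto
qed

text \<open>
  With \<open>\<theta> = f/g\<close>, the definition of the mean \<open>u\<close> says
  \<open>\<theta>(u) - \<theta>(x) = s g(y) / (t g(x) + s g(y)) (\<theta>(y) - \<theta>(x))\<close>; dividing by \<open>y - x\<close> and cancelling \<open>\<theta>'(x)\<close>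
  yields the slope.
\<close>

lemma bajraktarevic_mean_slope:
  assumes "open I" "is_interval I" "(f, g) \<in> reg_class 4 I" "x \<in> I" "t > 0" "s > 0"
  shows "((\<lambda>\<epsilon>. (bajraktarevic_mean I f g x (x + \<epsilon>) t s - x) / \<epsilon>) \<longlongrightarrow> s / (t + s)) (at 0)"
proof -
  note R = reg_class_4D[OF assms(1-3)]
  have cont: "continuous_on I f" "continuous_on I g"
    using times_cont_diff_on_imp_continuous_on[OF assms(1)] R(1,2) by auto
  define u where "u \<epsilon> = bajraktarevic_mean I f g x (x + \<epsilon>) t s" for \<epsilon>
  define \<theta> where "\<theta> y = f y / g y" for y
  define d where "d = (deriv f x * g x - f x * deriv g x) / (g x * g x)"
  have d: "d \<noteq> 0" using R(6)[OF assms(4)] R(3)[OF assms(4)] by (simp add: d_def)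
  have "(\<theta> has_real_derivative d) (at x)"
    unfolding \<theta>_def d_def using R(3-5)[OF assms(4)] by (intro DERIV_divide)
  then have slope: "((\<lambda>y. (\<theta> y - \<theta> x) / (y - x)) \<longlongrightarrow> d) (at x)"
    by (simp add: has_field_derivative_iff)
  have shift: "filterlim (\<lambda>\<epsilon>. x + \<epsilon>) (at x) (at 0)"
    by (auto simp: filterlim_at eventually_at_filter intro!: tendsto_eq_intros)
  have ev: "\<forall>\<^sub>F \<epsilon> in at 0. x + \<epsilon> \<in> I \<and> \<epsilon> \<noteq> 0"
    by (rule eventually_shift_in_open(2)[OF assms(1,4)])
  have props: "\<bar>u \<epsilon> - x\<bar> \<le> \<bar>\<epsilon>\<bar>" "u \<epsilon> \<noteq> x" "\<theta> (u \<epsilon>) \<noteq> \<theta> x"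
      "(\<theta> (u \<epsilon>) - \<theta> x) * (t * g x + s * g (x + \<epsilon>)) = s * g (x + \<epsilon>) * (\<theta> (x + \<epsilon>) - \<theta> x)"
    if "x + \<epsilon> \<in> I \<and> \<epsilon> \<noteq> 0" for \<epsilon>
  proof -
    have M: "u \<epsilon> \<in> closed_segment x (x + \<epsilon>)" "u \<epsilon> \<in> I"
       "t * wedge f g (u \<epsilon>) x = s * wedge f g (x + \<epsilon>) (u \<epsilon>)"
      using bajraktarevic_mean_props[OF assms(2) cont R(3,7) assms(4), of "x + \<epsilon>" t s] that assms(5,6)
      unfolding u_def by auto
    show "\<bar>u \<epsilon> - x\<bar> \<le> \<bar>\<epsilon>\<bar>"
      using M(1) by (auto simp: closed_segment_eq_real_ivl split: if_splits)
    have nz: "g x \<noteq> 0" "g (u \<epsilon>) \<noteq> 0" "g (x + \<epsilon>) \<noteq> 0"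
      using R(3) that M(2) assms(4) by auto
    then show "(\<theta> (u \<epsilon>) - \<theta> x) * (t * g x + s * g (x + \<epsilon>)) = s * g (x + \<epsilon>) * (\<theta> (x + \<epsilon>) - \<theta> x)"
      using M(3) unfolding wedge_def \<theta>_def by (simp add: field_simps)
    show "u \<epsilon> \<noteq> x"
    proof
      assume "u \<epsilon> = x"
      then have "\<theta> (x + \<epsilon>) = \<theta> x"
        using M(3) nz assms(6) by (simp add: wedge_def \<theta>_def field_simps)
      then show False
        using inj_onD[OF R(7), of "x + \<epsilon>" x] that assms(4) unfolding \<theta>_def by simp
    qed
    then show "\<theta> (u \<epsilon>) \<noteq> \<theta> x"
      using inj_onD[OF R(7), of "u \<epsilon>" x] M(2) assms(4) unfolding \<theta>_def by auto
  qed
  have "((\<lambda>\<epsilon>. u \<epsilon> - x) \<longlongrightarrow> 0) (at 0)"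
    by (rule Lim_null_comparison[OF eventually_mono[OF ev], where g = "\<lambda>\<epsilon>. \<bar>\<epsilon>\<bar>"])
       (auto simp: props intro!: tendsto_eq_intros)
  then have "filterlim u (at x) (at 0)"
    using eventually_mono[OF ev props(2)] by (simp add: filterlim_at LIM_zero_iff)
  then have "((\<lambda>\<epsilon>. (\<theta> (u \<epsilon>) - \<theta> x) / (u \<epsilon> - x)) \<longlongrightarrow> d) (at 0)"
    by (rule filterlim_compose[OF slope])
  moreover have "((\<lambda>\<epsilon>. (\<theta> (x + \<epsilon>) - \<theta> x) / \<epsilon>) \<longlongrightarrow> d) (at 0)"
    using filterlim_compose[OF slope shift] by simp
  moreover have g: "((\<lambda>\<epsilon>. g (x + \<epsilon>)) \<longlongrightarrow> g x) (at 0)"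
    using DERIV_isCont[OF R(5)[OF assms(4)]] by (simp add: isCont_def LIM_offset_zero)
  ultimately have "((\<lambda>\<epsilon>. (s * g (x + \<epsilon>) / (t * g x + s * g (x + \<epsilon>))) * ((\<theta> (x + \<epsilon>) - \<theta> x) / \<epsilon>)
      / ((\<theta> (u \<epsilon>) - \<theta> x) / (u \<epsilon> - x))) \<longlongrightarrow> (s * g x / (t * g x + s * g x)) * d / d) (at 0)"
    using d R(3)[OF assms(4)] assms(5,6)
    by (intro tendsto_intros) (auto simp: distrib_right[symmetric])
  moreover have "(s * g x / (t * g x + s * g x)) * d / d = s / (t + s)"
    using d R(3)[OF assms(4)] by (simp add: distrib_right[symmetric])
  moreover have "\<forall>\<^sub>F \<epsilon> in at 0. (s * g (x + \<epsilon>) / (t * g x + s * g (x + \<epsilon>))) * ((\<theta> (x + \<epsilon>) - \<theta> x) / \<epsilon>)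
      / ((\<theta> (u \<epsilon>) - \<theta> x) / (u \<epsilon> - x)) = (u \<epsilon> - x) / \<epsilon>"
  proof (rule eventually_mono[OF ev])
    fix \<epsilon> assume \<epsilon>: "x + \<epsilon> \<in> I \<and> \<epsilon> \<noteq> 0"
    have "g x * g (x + \<epsilon>) > 0"
      using \<epsilon> R(3) cont(2) assms(2,4) by (intro nonzero_on_interval_same_sign) auto
    then have D: "t * g x + s * g (x + \<epsilon>) \<noteq> 0"
      using assms(5,6) by (smt (verit) zero_less_mult_iff mult_less_0_iff)
    show "(s * g (x + \<epsilon>) / (t * g x + s * g (x + \<epsilon>))) * ((\<theta> (x + \<epsilon>) - \<theta> x) / \<epsilon>)
      / ((\<theta> (u \<epsilon>) - \<theta> x) / (u \<epsilon> - x)) = (u \<epsilon> - x) / \<epsilon>"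
      using props(2-4)[OF \<epsilon>] D \<epsilon> by (simp add: divide_simps) (simp add: algebra_simps)
  qed
  ultimately show ?thesis
    unfolding u_def by (auto intro: Lim_transform_eventually)
qed

section \<open>Consequences of the invariance equation\<close>

text \<open>
  The two sides of the product relation, with \<open>y = x + \<epsilon>\<close>.  The terms of order \<open>\<epsilon>\<^sup>2\<close> agree
  because \<open>v - x = y - u\<close> and \<open>y - v = u - x\<close>.  In the difference \<open>\<epsilon>\<^sup>4 Z\<close> of the two sides \<open>P\<close> and \<open>Q\<close>
  appear with opposite signs, as the intervals carrying them are exchanged.  If \<open>P\<close> and \<open>Q\<close>
  agree to first order at \<open>x\<close>, only the displacement of the midpoints of \<open>[x, u]\<close> and \<open>[v, y]\<close>, and of \<open>[x, v]\<close>
  and \<open>[u, y]\<close>, remains; it contributes a multiple of \<open>P'\<close>.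
\<close>

lemma wedge_product_expansion:
  fixes m :: "real \<Rightarrow> real"
  assumes "open I" "x \<in> I"
    and FG: "normal_pair I P F F' G G'" "(P has_real_derivative p1) (at x)"
    and HK: "normal_pair I Q H H' K K'" "(Q has_real_derivative q1) (at x)"
    and m: "(m \<longlongrightarrow> \<sigma>) (at 0)"
  defines "u \<equiv> \<lambda>\<epsilon>. x + \<epsilon> * m \<epsilon>" and "v \<equiv> \<lambda>\<epsilon>. x + \<epsilon> * (1 - m \<epsilon>)"
  obtains M Z where
    "\<forall>\<epsilon>. wedge F G (x + \<epsilon>) (u \<epsilon>) * wedge H K (x + \<epsilon>) (v \<epsilon>) = \<epsilon>\<^sup>2 * M \<epsilon>"
    "\<forall>\<epsilon>. wedge F G (u \<epsilon>) x * wedge H K (v \<epsilon>) x = \<epsilon>\<^sup>2 * M \<epsilon> + \<epsilon> ^ 4 * Z \<epsilon>"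
    "(M \<longlongrightarrow> \<sigma> * (1 - \<sigma>)) (at 0)"
    "(Z \<longlongrightarrow> (P x - Q x) * \<sigma> * (1 - \<sigma>) * (2 * \<sigma> - 1) / 6) (at 0)"
    "P x = Q x \<longrightarrow> p1 = q1 \<longrightarrow> ((\<lambda>\<epsilon>. Z \<epsilon> / \<epsilon>) \<longlongrightarrow> - p1 * \<sigma>\<^sup>2 * (1 - \<sigma>)\<^sup>2 / 6) (at 0)"
proof -
  note c0 = tendsto_const[of "0::real" "at (0::real)"] and c1 = tendsto_const[of "1::real" "at (0::real)"]
  have n: "((\<lambda>\<epsilon>. 1 - m \<epsilon>) \<longlongrightarrow> 1 - \<sigma>) (at 0)" by (intro tendsto_intros m)
  obtain k1 where k1: "(k1 \<longlongrightarrow> p1 * (\<sigma> - 0) ^ 3 * (0 + \<sigma>) / 12) (at 0)"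
    "\<And>\<epsilon>. wedge F G (x + \<epsilon> * m \<epsilon>) (x + \<epsilon> * 0) = \<epsilon> * (m \<epsilon> - 0) + P x * (\<epsilon> * (m \<epsilon> - 0)) ^ 3 / 6 + \<epsilon> ^ 4 * k1 \<epsilon>"
    using wedge_expansion[OF assms(1,2) FG c0 m] by metis
  obtain k2 where k2: "(k2 \<longlongrightarrow> q1 * ((1 - \<sigma>) - 0) ^ 3 * (0 + (1 - \<sigma>)) / 12) (at 0)"
    "\<And>\<epsilon>. wedge H K (x + \<epsilon> * (1 - m \<epsilon>)) (x + \<epsilon> * 0) = \<epsilon> * ((1 - m \<epsilon>) - 0) + Q x * (\<epsilon> * ((1 - m \<epsilon>) - 0)) ^ 3 / 6 + \<epsilon> ^ 4 * k2 \<epsilon>"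
    using wedge_expansion[OF assms(1,2) HK c0 n] by metis
  obtain k3 where k3: "(k3 \<longlongrightarrow> p1 * (1 - \<sigma>) ^ 3 * (\<sigma> + 1) / 12) (at 0)"
    "\<And>\<epsilon>. wedge F G (x + \<epsilon> * 1) (x + \<epsilon> * m \<epsilon>) = \<epsilon> * (1 - m \<epsilon>) + P x * (\<epsilon> * (1 - m \<epsilon>)) ^ 3 / 6 + \<epsilon> ^ 4 * k3 \<epsilon>"
    using wedge_expansion[OF assms(1,2) FG m c1] by metis
  obtain k4 where k4: "(k4 \<longlongrightarrow> q1 * (1 - (1 - \<sigma>)) ^ 3 * ((1 - \<sigma>) + 1) / 12) (at 0)"
    "\<And>\<epsilon>. wedge H K (x + \<epsilon> * 1) (x + \<epsilon> * (1 - m \<epsilon>)) = \<epsilon> * (1 - (1 - m \<epsilon>)) + Q x * (\<epsilon> * (1 - (1 - m \<epsilon>))) ^ 3 / 6 + \<epsilon> ^ 4 * k4 \<epsilon>"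
    using wedge_expansion[OF assms(1,2) HK n c1] by metis
  define X1 where "X1 \<epsilon> = P x * m \<epsilon> ^ 3 / 6 + \<epsilon> * k1 \<epsilon>" for \<epsilon>
  define X2 where "X2 \<epsilon> = Q x * (1 - m \<epsilon>) ^ 3 / 6 + \<epsilon> * k2 \<epsilon>" for \<epsilon>
  define X3 where "X3 \<epsilon> = P x * (1 - m \<epsilon>) ^ 3 / 6 + \<epsilon> * k3 \<epsilon>" for \<epsilon>
  define X4 where "X4 \<epsilon> = Q x * m \<epsilon> ^ 3 / 6 + \<epsilon> * k4 \<epsilon>" for \<epsilon>
  have X: "wedge F G (u \<epsilon>) x = \<epsilon> * (m \<epsilon> + \<epsilon>\<^sup>2 * X1 \<epsilon>)"
    "wedge H K (v \<epsilon>) x = \<epsilon> * ((1 - m \<epsilon>) + \<epsilon>\<^sup>2 * X2 \<epsilon>)"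
    "wedge F G (x + \<epsilon>) (u \<epsilon>) = \<epsilon> * ((1 - m \<epsilon>) + \<epsilon>\<^sup>2 * X3 \<epsilon>)"
    "wedge H K (x + \<epsilon>) (v \<epsilon>) = \<epsilon> * (m \<epsilon> + \<epsilon>\<^sup>2 * X4 \<epsilon>)" for \<epsilon>
    using k1(2)[of \<epsilon>] k2(2)[of \<epsilon>] k3(2)[of \<epsilon>] k4(2)[of \<epsilon>]
    unfolding u_def v_def X1_def X2_def X3_def X4_def
    by (simp_all add: power_mult_distrib ring_distribs power2_eq_square power3_eq_cube power4_eq_xxxx mult_ac)
  have limX: "(X1 \<longlongrightarrow> P x * \<sigma> ^ 3 / 6 + 0 * (p1 * (\<sigma> - 0) ^ 3 * (0 + \<sigma>) / 12)) (at 0)"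
    "(X2 \<longlongrightarrow> Q x * (1 - \<sigma>) ^ 3 / 6 + 0 * (q1 * ((1 - \<sigma>) - 0) ^ 3 * (0 + (1 - \<sigma>)) / 12)) (at 0)"
    "(X3 \<longlongrightarrow> P x * (1 - \<sigma>) ^ 3 / 6 + 0 * (p1 * (1 - \<sigma>) ^ 3 * (\<sigma> + 1) / 12)) (at 0)"
    "(X4 \<longlongrightarrow> Q x * \<sigma> ^ 3 / 6 + 0 * (q1 * (1 - (1 - \<sigma>)) ^ 3 * ((1 - \<sigma>) + 1) / 12)) (at 0)"
    unfolding X1_def X2_def X3_def X4_def by (intro tendsto_intros m n k1 k2 k3 k4; simp)+
  note limX = limX[unfolded mult_zero_left add_0_right]
  define M where "M \<epsilon> = ((1 - m \<epsilon>) + \<epsilon>\<^sup>2 * X3 \<epsilon>) * (m \<epsilon> + \<epsilon>\<^sup>2 * X4 \<epsilon>)" for \<epsilon>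
  define Z where "Z \<epsilon> = X1 \<epsilon> * (1 - m \<epsilon>) + X2 \<epsilon> * m \<epsilon> - X3 \<epsilon> * m \<epsilon> - X4 \<epsilon> * (1 - m \<epsilon>)
    + \<epsilon>\<^sup>2 * (X1 \<epsilon> * X2 \<epsilon> - X3 \<epsilon> * X4 \<epsilon>)" for \<epsilon>
  show ?thesis
  proof (rule that[of M Z]; (intro allI impI)?)
    show "wedge F G (x + \<epsilon>) (u \<epsilon>) * wedge H K (x + \<epsilon>) (v \<epsilon>) = \<epsilon>\<^sup>2 * M \<epsilon>" for \<epsilon>
      unfolding X M_def by (simp add: power2_eq_square)
    show "wedge F G (u \<epsilon>) x * wedge H K (v \<epsilon>) x = \<epsilon>\<^sup>2 * M \<epsilon> + \<epsilon> ^ 4 * Z \<epsilon>" for \<epsilon>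
      unfolding X M_def Z_def by algebra
    have "(M \<longlongrightarrow> ((1 - \<sigma>) + 0\<^sup>2 * (P x * (1 - \<sigma>) ^ 3 / 6)) * (\<sigma> + 0\<^sup>2 * (Q x * \<sigma> ^ 3 / 6))) (at 0)"
      unfolding M_def by (intro tendsto_intros m n limX)
    then show "(M \<longlongrightarrow> \<sigma> * (1 - \<sigma>)) (at 0)" by (simp add: mult.commute)
    have "(Z \<longlongrightarrow> (P x * \<sigma> ^ 3 / 6) * (1 - \<sigma>) + (Q x * (1 - \<sigma>) ^ 3 / 6) * \<sigma>
        - (P x * (1 - \<sigma>) ^ 3 / 6) * \<sigma> - (Q x * \<sigma> ^ 3 / 6) * (1 - \<sigma>)
        + 0\<^sup>2 * ((P x * \<sigma> ^ 3 / 6) * (Q x * (1 - \<sigma>) ^ 3 / 6) - (P x * (1 - \<sigma>) ^ 3 / 6) * (Q x * \<sigma> ^ 3 / 6))) (at 0)"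
      unfolding Z_def by (intro tendsto_intros m n limX)
    then show "(Z \<longlongrightarrow> (P x - Q x) * \<sigma> * (1 - \<sigma>) * (2 * \<sigma> - 1) / 6) (at 0)"
      by (rule tendsto_eq_rhs) (simp add: field_simps power2_eq_square power3_eq_cube)
    assume PQ: "P x = Q x" "p1 = q1"
    have "((\<lambda>\<epsilon>. k1 \<epsilon> * (1 - m \<epsilon>) + k2 \<epsilon> * m \<epsilon> - k3 \<epsilon> * m \<epsilon> - k4 \<epsilon> * (1 - m \<epsilon>)
        + \<epsilon> * (X1 \<epsilon> * X2 \<epsilon> - X3 \<epsilon> * X4 \<epsilon>)) \<longlongrightarrow>
        (p1 * (\<sigma> - 0) ^ 3 * (0 + \<sigma>) / 12) * (1 - \<sigma>) + (q1 * ((1 - \<sigma>) - 0) ^ 3 * (0 + (1 - \<sigma>)) / 12) * \<sigma>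
        - (p1 * (1 - \<sigma>) ^ 3 * (\<sigma> + 1) / 12) * \<sigma> - (q1 * (1 - (1 - \<sigma>)) ^ 3 * ((1 - \<sigma>) + 1) / 12) * (1 - \<sigma>)
        + 0 * ((P x * \<sigma> ^ 3 / 6) * (Q x * (1 - \<sigma>) ^ 3 / 6) - (P x * (1 - \<sigma>) ^ 3 / 6) * (Q x * \<sigma> ^ 3 / 6))) (at 0)"
      by (intro tendsto_intros m n limX k1 k2 k3 k4)
    then have "((\<lambda>\<epsilon>. k1 \<epsilon> * (1 - m \<epsilon>) + k2 \<epsilon> * m \<epsilon> - k3 \<epsilon> * m \<epsilon> - k4 \<epsilon> * (1 - m \<epsilon>)
        + \<epsilon> * (X1 \<epsilon> * X2 \<epsilon> - X3 \<epsilon> * X4 \<epsilon>)) \<longlongrightarrow> - p1 * \<sigma>\<^sup>2 * (1 - \<sigma>)\<^sup>2 / 6) (at 0)"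
      by (rule tendsto_eq_rhs) (simp add: PQ field_simps power2_eq_square power3_eq_cube)
    moreover have "k1 \<epsilon> * (1 - m \<epsilon>) + k2 \<epsilon> * m \<epsilon> - k3 \<epsilon> * m \<epsilon> - k4 \<epsilon> * (1 - m \<epsilon>)
        + \<epsilon> * (X1 \<epsilon> * X2 \<epsilon> - X3 \<epsilon> * X4 \<epsilon>) = Z \<epsilon> / \<epsilon>" if "\<epsilon> \<noteq> 0" for \<epsilon>
    proof -
      have "X1 \<epsilon> * (1 - m \<epsilon>) + X2 \<epsilon> * m \<epsilon> - X3 \<epsilon> * m \<epsilon> - X4 \<epsilon> * (1 - m \<epsilon>) =
        \<epsilon> * (k1 \<epsilon> * (1 - m \<epsilon>) + k2 \<epsilon> * m \<epsilon> - k3 \<epsilon> * m \<epsilon> - k4 \<epsilon> * (1 - m \<epsilon>))"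
        unfolding X1_def X2_def X3_def X4_def PQ by (simp add: field_simps)
      then show ?thesis
        using that unfolding Z_def by (simp add: field_simps power2_eq_square)
    qed
    ultimately show "((\<lambda>\<epsilon>. Z \<epsilon> / \<epsilon>) \<longlongrightarrow> - p1 * \<sigma>\<^sup>2 * (1 - \<sigma>)\<^sup>2 / 6) (at 0)"
      by (auto intro: Lim_transform_eventually simp: eventually_at_filter)
  qed
qed

text \<open>
  Multiplying the equations of the two means \<open>u\<close> and \<open>v = x + y - u\<close> eliminates the weights.  The
  resulting relation \<open>rel\<close> is evaluated at \<open>y = x + \<epsilon>\<close>, where \<open>u = x + \<epsilon> m(\<epsilon>)\<close> with \<open>m \<rightarrow> \<sigma> = s / (t + s)\<close>, and
  compared in increasing order.  To lowest order \<open>(w z)' = 0\<close>.  The next order gives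
  \<open>(P - Q) (2\<sigma> - 1) = 0\<close>, and it is here that the weights have to be different.  Knowing \<open>P = Q\<close>
  near \<open>x\<close>, the order after that gives \<open>P' = 0\<close>.
\<close>

lemma invariance_forces_constant_potential:
  assumes "open I" "is_interval I"
    and fg: "(f, g) \<in> reg_class 4 I" and hk: "(h, k) \<in> reg_class 4 I"
    and ts: "t > 0" "s > 0" "t \<noteq> s"
    and inv: "\<And>x y. x \<in> I \<Longrightarrow> y \<in> I \<Longrightarrow>
           bajraktarevic_mean I f g x y t s + bajraktarevic_mean I h k x y s t = x + y"
    and nz: "e \<noteq> 0" "e' \<noteq> 0"
    and FG: "normal_pair I P F F' G G'" and HK: "normal_pair I Q H H' K K'"
    and wfg: "\<forall>x\<in>I. w x > 0 \<and> f x = e * w x * F x \<and> g x = w x * G x"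
    and zhk: "\<forall>x\<in>I. z x > 0 \<and> h x = e' * z x * H x \<and> k x = z x * K x"
    and Pd: "P differentiable_on I" and Qd: "Q differentiable_on I"
  obtains c p where "\<And>x. x \<in> I \<Longrightarrow> w x * z x = c" "\<And>x. x \<in> I \<Longrightarrow> P x = p" "\<And>x. x \<in> I \<Longrightarrow> Q x = p"
proof -
  have w: "w x > 0" and f: "f x = e * w x * F x" and g: "g x = w x * G x"
    and z: "z x > 0" and h: "h x = e' * z x * H x" and k: "k x = z x * K x" if "x \<in> I" for x
    using wfg zhk that by auto
  note Dderiv = has_derivative_deriv_of_differentiable_on[OF assms(1)]
  note Rf = reg_class_4D[OF assms(1,2) fg] and Rh = reg_class_4D[OF assms(1,2) hk]
  note cont = times_cont_diff_on_imp_continuous_on[OF assms(1)]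
  define \<sigma> where "\<sigma> = s / (t + s)"
  have \<sigma>: "\<sigma> > 0" "1 - \<sigma> > 0" "2 * \<sigma> - 1 \<noteq> 0"
    using ts by (auto simp: \<sigma>_def field_simps)
  have rel: "w x * z x * (wedge F G u x * wedge H K (x + y - u) x) =
      w y * z y * (wedge F G y u * wedge H K y (x + y - u))"
    if xy: "x \<in> I" "y \<in> I" and u_def: "u = bajraktarevic_mean I f g x y t s" for x y u
  proof -
    define v where "v = bajraktarevic_mean I h k x y s t"
    have v: "v = x + y - u" using inv[OF xy] by (simp add: u_def v_def)
    have U: "u \<in> I" "t * wedge f g u x = s * wedge f g y u"
      unfolding u_def using bajraktarevic_mean_props[OF assms(2) cont[OF Rf(1)] cont[OF Rf(2)] Rf(3,7) xy ts(1,2)]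
      by auto
    have V: "v \<in> I" "s * wedge h k v x = t * wedge h k y v"
      unfolding v_def using bajraktarevic_mean_props[OF assms(2) cont[OF Rh(1)] cont[OF Rh(2)] Rh(3,7) xy ts(2,1)]
      by auto
    have wf: "wedge f g b a = e * w a * w b * wedge F G b a" if "a \<in> I" "b \<in> I" for a b
      using that by (simp add: wedge_def f g algebra_simps)
    have wh: "wedge h k b a = e' * z a * z b * wedge H K b a" if "a \<in> I" "b \<in> I" for a b
      using that by (simp add: wedge_def h k algebra_simps)
    have "e * w u * (t * w x * wedge F G u x) = e * w u * (s * w y * wedge F G y u)"
      using U(2) by (simp add: wf U(1) xy mult_ac)
    then have 1: "t * w x * wedge F G u x = s * w y * wedge F G y u"
      using nz w[OF U(1)] by simp
    have "e' * z v * (s * z x * wedge H K v x) = e' * z v * (t * z y * wedge H K y v)"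
      using V(2) by (simp add: wh V(1) xy mult_ac)
    then have 2: "s * z x * wedge H K v x = t * z y * wedge H K y v"
      using nz z[OF V(1)] by simp
    have "(t * s) * (w x * z x * (wedge F G u x * wedge H K v x)) =
        (t * w x * wedge F G u x) * (s * z x * wedge H K v x)" by (simp add: mult_ac)
    also have "\<dots> = (t * s) * (w y * z y * (wedge F G y u * wedge H K y v))"
      unfolding 1 2 by (simp add: mult_ac)
    finally show ?thesis using ts(1,2) by (simp add: v)
  qed
  have local_expansion: "\<exists>Z M.
      (\<forall>\<^sub>F \<epsilon> in at 0. w x * z x * (M \<epsilon> + \<epsilon>\<^sup>2 * Z \<epsilon>) = w (x + \<epsilon>) * z (x + \<epsilon>) * M \<epsilon>) \<and>
      (M \<longlongrightarrow> \<sigma> * (1 - \<sigma>)) (at 0) \<and>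
      (Z \<longlongrightarrow> (P x - Q x) * \<sigma> * (1 - \<sigma>) * (2 * \<sigma> - 1) / 6) (at 0) \<and>
      (P x = Q x \<longrightarrow> deriv P x = deriv Q x \<longrightarrow>
         ((\<lambda>\<epsilon>. Z \<epsilon> / \<epsilon>) \<longlongrightarrow> - deriv P x * \<sigma>\<^sup>2 * (1 - \<sigma>)\<^sup>2 / 6) (at 0))" if x: "x \<in> I" for x
  proof -
    define m where "m \<epsilon> = (bajraktarevic_mean I f g x (x + \<epsilon>) t s - x) / \<epsilon>" for \<epsilon>
    have m: "(m \<longlongrightarrow> \<sigma>) (at 0)"
      unfolding m_def \<sigma>_def using bajraktarevic_mean_slope[OF assms(1,2) fg x ts(1,2)] .
    obtain M Z where
      ZM: "\<forall>\<epsilon>. wedge F G (x + \<epsilon>) (x + \<epsilon> * m \<epsilon>) * wedge H K (x + \<epsilon>) (x + \<epsilon> * (1 - m \<epsilon>)) = \<epsilon>\<^sup>2 * M \<epsilon>"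
      "\<forall>\<epsilon>. wedge F G (x + \<epsilon> * m \<epsilon>) x * wedge H K (x + \<epsilon> * (1 - m \<epsilon>)) x = \<epsilon>\<^sup>2 * M \<epsilon> + \<epsilon> ^ 4 * Z \<epsilon>"
      "(M \<longlongrightarrow> \<sigma> * (1 - \<sigma>)) (at 0)"
      "(Z \<longlongrightarrow> (P x - Q x) * \<sigma> * (1 - \<sigma>) * (2 * \<sigma> - 1) / 6) (at 0)"
      "P x = Q x \<longrightarrow> deriv P x = deriv Q x \<longrightarrow>
         ((\<lambda>\<epsilon>. Z \<epsilon> / \<epsilon>) \<longlongrightarrow> - deriv P x * \<sigma>\<^sup>2 * (1 - \<sigma>)\<^sup>2 / 6) (at 0)"
      by (rule wedge_product_expansion[OF assms(1) x FG Dderiv[OF Pd x] HK Dderiv[OF Qd x] m])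
    have "\<forall>\<^sub>F \<epsilon> in at 0. x + \<epsilon> \<in> I \<and> \<epsilon> \<noteq> 0"
      by (rule eventually_shift_in_open(2)[OF assms(1) x])
    then have "\<forall>\<^sub>F \<epsilon> in at 0. w x * z x * (M \<epsilon> + \<epsilon>\<^sup>2 * Z \<epsilon>) = w (x + \<epsilon>) * z (x + \<epsilon>) * M \<epsilon>"
    proof (rule eventually_mono)
      fix \<epsilon> assume \<epsilon>: "x + \<epsilon> \<in> I \<and> \<epsilon> \<noteq> 0"
      then have u: "x + \<epsilon> * m \<epsilon> = bajraktarevic_mean I f g x (x + \<epsilon>) t s" by (simp add: m_def)
      have v: "x + (x + \<epsilon>) - (x + \<epsilon> * m \<epsilon>) = x + \<epsilon> * (1 - m \<epsilon>)" by (simp add: algebra_simps)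
      have "w x * z x * (\<epsilon>\<^sup>2 * M \<epsilon> + \<epsilon> ^ 4 * Z \<epsilon>) = w (x + \<epsilon>) * z (x + \<epsilon>) * (\<epsilon>\<^sup>2 * M \<epsilon>)"
        using rel[OF x conjunct1[OF \<epsilon>] u] unfolding v ZM(1)[rule_format] ZM(2)[rule_format] .
      then have "\<epsilon>\<^sup>2 * (w x * z x * (M \<epsilon> + \<epsilon>\<^sup>2 * Z \<epsilon>)) = \<epsilon>\<^sup>2 * (w (x + \<epsilon>) * z (x + \<epsilon>) * M \<epsilon>)"
        by algebra
      then show "w x * z x * (M \<epsilon> + \<epsilon>\<^sup>2 * Z \<epsilon>) = w (x + \<epsilon>) * z (x + \<epsilon>) * M \<epsilon>"
        using \<epsilon> by simp
    qed
    with ZM(3-5) show ?thesis by blast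
  qed
  have uniq: "L = L'" if "(X \<longlongrightarrow> L) (at 0)" "(X \<longlongrightarrow> L') (at 0)" for X :: "real \<Rightarrow> real" and L L'
    using tendsto_unique[OF _ that] by simp
  have "((\<lambda>x. w x * z x) has_real_derivative 0) (at x)" if x: "x \<in> I" for x
  proof -
    obtain Z M where ev: "\<forall>\<^sub>F \<epsilon> in at 0. w x * z x * (M \<epsilon> + \<epsilon>\<^sup>2 * Z \<epsilon>) = w (x + \<epsilon>) * z (x + \<epsilon>) * M \<epsilon>"
      and M: "(M \<longlongrightarrow> \<sigma> * (1 - \<sigma>)) (at 0)"
      and Z: "(Z \<longlongrightarrow> (P x - Q x) * \<sigma> * (1 - \<sigma>) * (2 * \<sigma> - 1) / 6) (at 0)"
      using local_expansion[OF x] by blast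
    have "\<forall>\<^sub>F \<epsilon> in at 0. M \<epsilon> \<noteq> 0"
      using tendsto_imp_eventually_ne[OF M] \<sigma> by simp
    with ev have "\<forall>\<^sub>F \<epsilon> in at 0. w x * z x * \<epsilon> * Z \<epsilon> / M \<epsilon> =
        (w (x + \<epsilon>) * z (x + \<epsilon>) - w x * z x) / \<epsilon>"
      using eventually_neq_at_within[of 0]
    proof eventually_elim
      case (elim \<epsilon>)
      then have "(w (x + \<epsilon>) * z (x + \<epsilon>) - w x * z x) * M \<epsilon> = w x * z x * \<epsilon> * Z \<epsilon> * \<epsilon>" by algebra
      then show ?case using elim by (simp add: field_simps)
    qed
    moreover have "((\<lambda>\<epsilon>. w x * z x * \<epsilon> * Z \<epsilon> / M \<epsilon>) \<longlongrightarrow>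
       w x * z x * 0 * ((P x - Q x) * \<sigma> * (1 - \<sigma>) * (2 * \<sigma> - 1) / 6) / (\<sigma> * (1 - \<sigma>))) (at 0)"
      using \<sigma> by (intro tendsto_intros M Z) auto
    ultimately have "((\<lambda>\<epsilon>. (w (x + \<epsilon>) * z (x + \<epsilon>) - w x * z x) / \<epsilon>) \<longlongrightarrow> 0) (at 0)"
      by (auto intro: Lim_transform_eventually)
    then show ?thesis by (simp add: DERIV_def)
  qed
  then obtain c where c: "\<And>x. x \<in> I \<Longrightarrow> w x * z x = c"
    using interval_zero_derivative_constant[OF assms(2), of "\<lambda>x. w x * z x"] by blast
  have Z0: "\<exists>Z. (\<forall>\<^sub>F \<epsilon> in at 0. Z \<epsilon> = 0) \<and>
      (Z \<longlongrightarrow> (P x - Q x) * \<sigma> * (1 - \<sigma>) * (2 * \<sigma> - 1) / 6) (at 0) \<and>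
      (P x = Q x \<longrightarrow> deriv P x = deriv Q x \<longrightarrow>
         ((\<lambda>\<epsilon>. Z \<epsilon> / \<epsilon>) \<longlongrightarrow> - deriv P x * \<sigma>\<^sup>2 * (1 - \<sigma>)\<^sup>2 / 6) (at 0))" if x: "x \<in> I" for x
  proof -
    obtain Z M where ev: "\<forall>\<^sub>F \<epsilon> in at 0. w x * z x * (M \<epsilon> + \<epsilon>\<^sup>2 * Z \<epsilon>) = w (x + \<epsilon>) * z (x + \<epsilon>) * M \<epsilon>"
      and Z: "(Z \<longlongrightarrow> (P x - Q x) * \<sigma> * (1 - \<sigma>) * (2 * \<sigma> - 1) / 6) (at 0)"
      "P x = Q x \<longrightarrow> deriv P x = deriv Q x \<longrightarrow>
         ((\<lambda>\<epsilon>. Z \<epsilon> / \<epsilon>) \<longlongrightarrow> - deriv P x * \<sigma>\<^sup>2 * (1 - \<sigma>)\<^sup>2 / 6) (at 0)"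
      using local_expansion[OF x] by blast
    have "\<forall>\<^sub>F \<epsilon> in at 0. x + \<epsilon> \<in> I \<and> \<epsilon> \<noteq> 0"
      by (rule eventually_shift_in_open(2)[OF assms(1) x])
    with ev have "\<forall>\<^sub>F \<epsilon> in at 0. Z \<epsilon> = 0"
    proof eventually_elim
      case (elim \<epsilon>)
      moreover have "w x * z x > 0" using w z x by simp
      ultimately show ?case using c[of x] c[of "x + \<epsilon>"] x by (auto simp: algebra_simps)
    qed
    with Z show ?thesis by blast
  qed
  have PQ: "P x = Q x" if x: "x \<in> I" for x
  proof -
    obtain Z :: "real \<Rightarrow> real" where "\<forall>\<^sub>F \<epsilon> in at 0. Z \<epsilon> = 0"
      and Z: "(Z \<longlongrightarrow> (P x - Q x) * \<sigma> * (1 - \<sigma>) * (2 * \<sigma> - 1) / 6) (at 0)"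
      using Z0[OF x] by blast
    then have "(Z \<longlongrightarrow> 0) (at 0)" by (simp add: tendsto_eventually)
    from uniq[OF Z this] show ?thesis using \<sigma> by simp
  qed
  have "(P has_real_derivative 0) (at x)" if x: "x \<in> I" for x
  proof -
    have "deriv P x = deriv Q x" using deriv_cong_on_open[OF assms(1) x] PQ by blast
    then obtain Z where ev: "\<forall>\<^sub>F \<epsilon> in at 0. Z \<epsilon> = 0"
      and Z: "((\<lambda>\<epsilon>. Z \<epsilon> / \<epsilon>) \<longlongrightarrow> - deriv P x * \<sigma>\<^sup>2 * (1 - \<sigma>)\<^sup>2 / 6) (at 0)"
      using Z0[OF x] PQ[OF x] by blast
    have "((\<lambda>\<epsilon>. Z \<epsilon> / \<epsilon>) \<longlongrightarrow> 0) (at 0)"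
      by (rule tendsto_eventually) (rule eventually_mono[OF ev], simp)
    from uniq[OF Z this] have "deriv P x = 0" using \<sigma> by simp
    then show ?thesis using Dderiv[OF Pd x] by simp
  qed
  then obtain p where P: "\<And>x. x \<in> I \<Longrightarrow> P x = p"
    using interval_zero_derivative_constant[OF assms(2), of P] by blast
  with c PQ show ?thesis by (intro that[of c p]) auto
qed

text \<open>
  Both normal pairs now solve \<open>Y'' = p Y\<close>, as do the sine and cosine type functions, so all three are
  related by linear changes of basis.
\<close>

lemma sin_cos_type_of_invariance:
  assumes "open I" "is_interval I" "I \<noteq> {}"
    and fg: "(f, g) \<in> reg_class 4 I" and hk: "(h, k) \<in> reg_class 4 I"
    and ts: "t > 0" "s > 0" "t \<noteq> s"
    and inv: "\<And>x y. x \<in> I \<Longrightarrow> y \<in> I \<Longrightarrow>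
           bajraktarevic_mean I f g x y t s + bajraktarevic_mean I h k x y s t = x + y"
  obtains \<phi> p where "\<And>x. x \<in> I \<Longrightarrow> \<phi> x > 0" "times_cont_diff_on 4 \<phi> I"
    "pair_equiv_on I (f, g) (\<lambda>x. sin_type p x / \<phi> x, \<lambda>x. cos_type p x / \<phi> x)"
    "pair_equiv_on I (h, k) (\<lambda>x. sin_type p x * \<phi> x, \<lambda>x. cos_type p x * \<phi> x)"
proof -
  obtain e P F F' G G' w where e: "e * e = (1::real)" and FG: "normal_pair I P F F' G G'"
    and wfg: "\<forall>x\<in>I. w x > 0 \<and> f x = e * w x * F x \<and> g x = w x * G x"
    and Pd: "P differentiable_on I"
    by (rule normal_form_exists[OF assms(1,2) fg])
  obtain e' Q H H' K K' z where e': "e' * e' = (1::real)" and HK: "normal_pair I Q H H' K K'"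
    and zhk: "\<forall>x\<in>I. z x > 0 \<and> h x = e' * z x * H x \<and> k x = z x * K x"
    and Qd: "Q differentiable_on I"
    by (rule normal_form_exists[OF assms(1,2) hk])
  have nz: "e \<noteq> 0" "e' \<noteq> 0" using e e' by auto
  have w: "w x > 0" and f: "f x = e * w x * F x" and g: "g x = w x * G x"
    and z: "z x > 0" and h: "h x = e' * z x * H x" and k: "k x = z x * K x" if "x \<in> I" for x
    using wfg zhk that by auto
  note Rf = reg_class_4D[OF assms(1,2) fg]
  obtain c p where c: "\<And>x. x \<in> I \<Longrightarrow> w x * z x = c"
    and P: "\<And>x. x \<in> I \<Longrightarrow> P x = p" and Q: "\<And>x. x \<in> I \<Longrightarrow> Q x = p"
    using invariance_forces_constant_potential[OF assms(1,2) fg hk ts inv nz FG HK wfg zhk Pd Qd]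
    by blast
  have FG': "normal_pair I (\<lambda>x. p) F F' G G'" and HK': "normal_pair I (\<lambda>x. p) H H' K K'"
    using FG HK P Q by (auto simp: normal_pair_def)
  obtain \<kappa> S' C' where \<kappa>: "\<kappa> \<noteq> 0" and SC: "normal_pair I (\<lambda>x. p) (\<lambda>x. sin_type p x / \<kappa>) S' (cos_type p) C'"
    by (rule sin_cos_type_normal_pair)
  \<comment> \<open>This is \<open>1 / w\<close>.  As \<open>w\<close> is built from first derivatives of \<open>f\<close> and \<open>g\<close>, it would lose one order
    of differentiability, whereas \<open>G\<close> is smooth now that its potential is constant.\<close>
  define \<phi> where "\<phi> x = G x / g x" for x
  have Gnz: "G x \<noteq> 0" if "x \<in> I" for x using Rf(3)[OF that] g[OF that] by auto
  have \<phi>: "\<phi> x = 1 / w x" "\<phi> x = z x / c" if "x \<in> I" for x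
    using g[OF that] Gnz[OF that] w[OF that] z[OF that] c[OF that, symmetric]
    by (simp_all add: \<phi>_def)
  have cnz: "c \<noteq> 0" using assms(3) c w z by fastforce
  show ?thesis
  proof (rule that[of \<phi> p])
    show "\<phi> x > 0" if "x \<in> I" for x using \<phi>(1)[OF that] w[OF that] by simp
    show "times_cont_diff_on 4 \<phi> I"
      unfolding \<phi>_def
      using normal_pairD(3,4)[OF FG']
      by (intro times_cont_diff_on_divide Rf assms(1) times_cont_diff_on_constant_potential[where p = p and Y' = G']) auto
    obtain \<alpha> \<beta> \<gamma> \<delta> where 1: "\<forall>x\<in>I. sin_type p x / \<kappa> = \<alpha> * F x + \<beta> * G x \<and>
        cos_type p x = \<gamma> * F x + \<delta> * G x" "\<alpha> * \<delta> - \<beta> * \<gamma> = 1"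
      by (rule normal_pairs_equivalent[OF assms(2,3) FG' SC])
    show "pair_equiv_on I (f, g) (\<lambda>x. sin_type p x / \<phi> x, \<lambda>x. cos_type p x / \<phi> x)"
      unfolding pair_equiv_on_def prod.case
    proof (intro exI conjI ballI)
      have "(\<kappa> * e * \<alpha>) * \<delta> - (\<kappa> * \<beta>) * (e * \<gamma>) = \<kappa> * e"
        using 1(2) by algebra
      then show "(\<kappa> * e * \<alpha>) * \<delta> \<noteq> (\<kappa> * \<beta>) * (e * \<gamma>)"
        using \<kappa> nz 1(2) by auto
      fix x assume x: "x \<in> I"
      have "e * f x = w x * F x" using f[OF x] e by algebra
      moreover have "sin_type p x = \<kappa> * (\<alpha> * F x + \<beta> * G x)" using 1(1) x \<kappa> by (simp add: field_simps)
      ultimately show "sin_type p x / \<phi> x = (\<kappa> * e * \<alpha>) * f x + (\<kappa> * \<beta>) * g x"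
        "cos_type p x / \<phi> x = (e * \<gamma>) * f x + \<delta> * g x"
        using \<phi>(1)[OF x] bspec[OF 1(1) x] g[OF x] by (simp_all add: algebra_simps)
    qed
    obtain \<alpha>' \<beta>' \<gamma>' \<delta>' where 2: "\<forall>x\<in>I. sin_type p x / \<kappa> = \<alpha>' * H x + \<beta>' * K x \<and>
        cos_type p x = \<gamma>' * H x + \<delta>' * K x" "\<alpha>' * \<delta>' - \<beta>' * \<gamma>' = 1"
      by (rule normal_pairs_equivalent[OF assms(2,3) HK' SC])
    show "pair_equiv_on I (h, k) (\<lambda>x. sin_type p x * \<phi> x, \<lambda>x. cos_type p x * \<phi> x)"
      unfolding pair_equiv_on_def prod.case
    proof (intro exI conjI ballI)
      have "(\<kappa> * e' * \<alpha>' / c) * (\<delta>' / c) - (\<kappa> * \<beta>' / c) * (e' * \<gamma>' / c) =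
          \<kappa> * e' * (\<alpha>' * \<delta>' - \<beta>' * \<gamma>') / (c * c)"
        using cnz by (simp add: field_simps)
      then show "(\<kappa> * e' * \<alpha>' / c) * (\<delta>' / c) \<noteq> (\<kappa> * \<beta>' / c) * (e' * \<gamma>' / c)"
        using \<kappa> nz cnz 2(2) by auto
      fix x assume x: "x \<in> I"
      have "e' * h x = z x * H x" using h[OF x] e' by algebra
      then have hk: "e' * h x / c = \<phi> x * H x" "k x / c = \<phi> x * K x"
        using \<phi>(2)[OF x] k[OF x] by simp_all
      have "sin_type p x = \<kappa> * (\<alpha>' * H x + \<beta>' * K x)" using 2(1) x \<kappa> by (simp add: field_simps)
      then have "sin_type p x * \<phi> x = \<kappa> * (\<alpha>' * (\<phi> x * H x) + \<beta>' * (\<phi> x * K x))"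
        by (simp add: algebra_simps)
      then show "sin_type p x * \<phi> x = (\<kappa> * e' * \<alpha>' / c) * h x + (\<kappa> * \<beta>' / c) * k x"
        unfolding hk[symmetric] by (simp add: algebra_simps)
      have "cos_type p x * \<phi> x = \<gamma>' * (\<phi> x * H x) + \<delta>' * (\<phi> x * K x)"
        using bspec[OF 2(1) x] by (simp add: algebra_simps)
      then show "cos_type p x * \<phi> x = (e' * \<gamma>' / c) * h x + (\<delta>' / c) * k x"
        unfolding hk[symmetric] by (simp add: algebra_simps)
    qed
  qed
qed

theorem theorem6:
  fixes I :: "real set"
  assumes "open I" and "is_interval I" and "I \<noteq> {}"
  shows
    "(\<forall>(p::real) (\<phi>::real \<Rightarrow> real) f g h k.
        continuous_on I \<phi> \<and> (\<forall>x\<in>I. \<phi> x > 0) \<and>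
        (f, g) \<in> reg_class 0 I \<and> (h, k) \<in> reg_class 0 I \<and>
        pair_equiv_on I (f, g) (\<lambda>x. sin_type p x / \<phi> x, \<lambda>x. cos_type p x / \<phi> x) \<and>
        pair_equiv_on I (h, k) (\<lambda>x. sin_type p x * \<phi> x, \<lambda>x. cos_type p x * \<phi> x) \<longrightarrow>
        (\<forall>s>0. \<forall>t>0. \<forall>x\<in>I. \<forall>y\<in>I.
           bajraktarevic_mean I f g x y t s + bajraktarevic_mean I h k x y s t = x + y))
     \<and>
     (\<forall>f g h k (t::real) (s::real).
        (f, g) \<in> reg_class 4 I \<and> (h, k) \<in> reg_class 4 I \<and> t > 0 \<and> s > 0 \<and> t \<noteq> s \<and>
        (\<forall>x\<in>I. \<forall>y\<in>I.
           bajraktarevic_mean I f g x y t s + bajraktarevic_mean I h k x y s t = x + y) \<longrightarrow>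
        (\<exists>(\<phi>::real \<Rightarrow> real) (p::real).
           (\<forall>x\<in>I. \<phi> x > 0) \<and> times_cont_diff_on 4 \<phi> I \<and>
           pair_equiv_on I (f, g) (\<lambda>x. sin_type p x / \<phi> x, \<lambda>x. cos_type p x / \<phi> x) \<and>
           pair_equiv_on I (h, k) (\<lambda>x. sin_type p x * \<phi> x, \<lambda>x. cos_type p x * \<phi> x)))"
proof (intro conjI allI impI ballI)
  fix p s t x y :: real and \<phi> f g h k :: "real \<Rightarrow> real"
  assume *: "continuous_on I \<phi> \<and> (\<forall>x\<in>I. \<phi> x > 0) \<and>
        (f, g) \<in> reg_class 0 I \<and> (h, k) \<in> reg_class 0 I \<and>
        pair_equiv_on I (f, g) (\<lambda>x. sin_type p x / \<phi> x, \<lambda>x. cos_type p x / \<phi> x) \<and>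
        pair_equiv_on I (h, k) (\<lambda>x. sin_type p x * \<phi> x, \<lambda>x. cos_type p x * \<phi> x)"
    and "s > 0" "t > 0" "x \<in> I" "y \<in> I"
  then show "bajraktarevic_mean I f g x y t s + bajraktarevic_mean I h k x y s t = x + y"
    using assms(2) by (intro invariance_of_sin_cos_type[where p = p and \<phi> = \<phi>]) simp_all
next
  fix f g h k :: "real \<Rightarrow> real" and t s :: real
  assume *: "(f, g) \<in> reg_class 4 I \<and> (h, k) \<in> reg_class 4 I \<and> t > 0 \<and> s > 0 \<and> t \<noteq> s \<and>
        (\<forall>x\<in>I. \<forall>y\<in>I.
           bajraktarevic_mean I f g x y t s + bajraktarevic_mean I h k x y s t = x + y)"
  show "\<exists>\<phi> p. (\<forall>x\<in>I. \<phi> x > 0) \<and> times_cont_diff_on 4 \<phi> I \<and>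
           pair_equiv_on I (f, g) (\<lambda>x. sin_type p x / \<phi> x, \<lambda>x. cos_type p x / \<phi> x) \<and>
           pair_equiv_on I (h, k) (\<lambda>x. sin_type p x * \<phi> x, \<lambda>x. cos_type p x * \<phi> x)"
    by (rule sin_cos_type_of_invariance[OF assms, of f g h k t s]; use * in blast)
qed

end
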